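(* Writing $E_a=\mathcal E_{a,19}$, the following hold: $E_2E_5-E_4E_5+E_7E_5-3E_9E_5+E_{11}E_5+E_{13}E_5+E_7E_9-E_7E_{11}-E_2E_{13}-E_3E_{13}+E_9E_{13}-E_{11}E_{13}=0$; $-E_1E_5+E_2E_5+E_3E_5-E_4E_5+E_7E_5-E_{11}E_5-E_{13}E_5+E_1E_7-E_2E_{13}-E_3E_{13}+E_{11}E_{13}=0$; $-E_2E_5-E_3E_5+E_7E_5-E_9E_5+E_{11}E_5+E_{13}E_5+E_2E_7-E_7E_{11}+E_2E_{13}-E_{11}E_{13}=0$; $E_2E_5+E_3E_5-E_7E_5-E_{11}E_5-E_{13}E_5+E_3E_{11}-E_2E_{13}-E_3E_{13}+E_{11}E_{13}=0$; $-E_2E_5-E_3E_5+E_7E_5+E_9E_5+E_{13}E_5+E_2E_{11}+E_3E_{13}-E_{11}E_{13}=0$; $-E_2E_5-E_3E_5+E_4E_5+E_9E_5+E_1E_9+E_2E_{13}+E_3E_{13}=0$; $-E_2E_3+E_5E_3+E_9E_3+E_2E_5-E_4E_5-E_2E_{13}=0$; $-E_3E_5-E_9E_5+E_{13}E_5+E_1E_{13}+E_3E_{13}=0$; $E_3E_5-E_4E_5+E_4E_{11}-E_3E_{13}=0$; $E_2E_4-E_5E_9-E_3E_{13}=0$.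
   Context: $q=e^{2\pi i\tau}$. For an odd Dirichlet character $\chi$ mod $19$, $E_{1,\chi}(\tau)=1+\frac{2}{L(0,\chi)}\sum_{n\ge1}\chi(n)\frac{q^n}{1-q^n}$ ($L(0,\chi)$ the value at $0$ of the continued $L$-function). For $a$ coprime to $19$, $\mathcal E_{a,19}=\frac{2}{18}\sum_{\chi\text{ odd mod }19}\chi(a)E_{1,\chi}$ (equivalently $(\gamma_{21}\tau+\gamma_{22})^{-1}\mathcal E_{1,19}(\gamma\tau)$ for $\gamma\in SL(2,\mathbb Z)$, $\gamma_{21}\equiv0$, $\gamma_{22}\equiv a\pmod{19}$). *)

theory Defs
  imports "HOL-Complex_Analysis.Complex_Analysis" "HOL-Number_Theory.Number_Theory"
begin

text \<open>Dirichlet characters mod \<open>N\<close>, not necessarily primitive, as \<open>N\<close>-periodic functions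
  on the integers.\<close>

definition dirichlet_character :: "nat \<Rightarrow> (int \<Rightarrow> complex) \<Rightarrow> bool" where
  "dirichlet_character N \<psi> \<longleftrightarrow>
     \<psi> 1 = 1 \<and>
     (\<forall>m n. \<psi> (m * n) = \<psi> m * \<psi> n) \<and>
     (\<forall>n. \<psi> (n + int N) = \<psi> n) \<and>
     (\<forall>n. \<psi> n = 0 \<longleftrightarrow> \<not> coprime n (int N))"

definition odd_characters :: "nat \<Rightarrow> (int \<Rightarrow> complex) set" where
  "odd_characters N = {\<psi>. dirichlet_character N \<psi> \<and> \<psi> (-1) = -1}"

text \<open>The continuation to \<open>\<complex> - {1}\<close> of the Dirichlet series. For a character it exists and is
  unique (\<open>\<complex> - {1}\<close> is connected), so the description is proper for every \<open>s \<noteq> 1\<close>; at \<open>s = 1\<close>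
  the value is left unspecified.\<close>

definition dirichlet_L :: "(int \<Rightarrow> complex) \<Rightarrow> complex \<Rightarrow> complex" where
  "dirichlet_L \<psi> s =
     (THE z. \<exists>f. f holomorphic_on (- {1}) \<and>
        (\<forall>w. 1 < Re w \<longrightarrow> (\<lambda>n. \<psi> (int (Suc n)) / of_nat (Suc n) powr w) sums f w) \<and>
        z = f s)"

definition eisenstein_E1 :: "(int \<Rightarrow> complex) \<Rightarrow> complex \<Rightarrow> complex" where
  "eisenstein_E1 \<psi> \<tau> =
     (let q = exp (2 * of_real pi * \<i> * \<tau>)
      in 1 + 2 / dirichlet_L \<psi> 0 * (\<Sum>n. \<psi> (int (Suc n)) * (q ^ Suc n / (1 - q ^ Suc n))))"

text \<open>For a prime \<open>p\<close> and \<open>a\<close> coprime to \<open>p\<close>.\<close>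

definition eisenstein_E :: "nat \<Rightarrow> int \<Rightarrow> complex \<Rightarrow> complex" where
  "eisenstein_E p a \<tau> =
     2 / (of_nat p - 1) * (\<Sum>\<psi>\<in>odd_characters p. \<psi> a * eisenstein_E1 \<psi> \<tau>)"

text \<open>The sum above is a genuine finite one.\<close>

lemma finite_odd_characters:
  assumes N: "N > 0"
  shows "finite (odd_characters N)"
proof -
  define k where "k = totient N"
  have k: "k > 0" using N by (simp add: k_def)
  define V where "V = insert (0::complex) {z. z ^ k = 1}"
  have fin: "finite V" using k by (simp add: V_def finite_roots_unity)
  have per: "\<psi> n = \<psi> (n mod int N)" if \<psi>: "dirichlet_character N \<psi>" for \<psi> n
  proof -
    have up: "\<psi> (m + int N * int j) = \<psi> m" for m j
    proof (induction j)
      case (Suc j)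
      have "\<psi> (m + int N * int (Suc j)) = \<psi> ((m + int N * int j) + int N)"
        by (simp add: algebra_simps)
      also have "\<dots> = \<psi> m" using \<psi> Suc unfolding dirichlet_character_def by metis
      finally show ?case .
    qed simp
    have "\<psi> (m + int N * j) = \<psi> m" for m j
      using up[of m "nat j"] up[of "m + int N * j" "nat (-j)"] by (cases "j \<ge> 0") auto
    from this[of "n mod int N" "n div int N"] show ?thesis by simp
  qed
  have val: "\<psi> n \<in> V" if \<psi>: "dirichlet_character N \<psi>" for \<psi> n
  proof (cases "coprime n (int N)")
    case False
    thus ?thesis using \<psi> by (auto simp: V_def dirichlet_character_def)
  next
    case True
    define m where "m = nat (n mod int N)"
    have m: "int m = n mod int N" using N by (simp add: m_def)
    have "coprime (int m) (int N)" using True N unfolding m by simp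
    hence "coprime m N" by simp
    hence "[m ^ k = 1] (mod N)" unfolding k_def by (rule euler_theorem)
    hence c: "int m ^ k mod int N = 1 mod int N"
      unfolding cong_def by (metis of_nat_1 of_nat_mod of_nat_power)
    have "\<psi> (x ^ j) = \<psi> x ^ j" for x j
      using \<psi> by (induction j) (auto simp: dirichlet_character_def)
    hence "\<psi> n ^ k = \<psi> (int m ^ k)" using per[OF \<psi>, of n] by (simp add: m)
    also have "\<dots> = \<psi> 1" using per[OF \<psi>] c by metis
    also have "\<dots> = 1" using \<psi> by (simp add: dirichlet_character_def)
    finally show ?thesis by (simp add: V_def)
  qed
  have "inj_on (\<lambda>\<psi>. restrict \<psi> {0..<int N}) (odd_characters N)"
  proof (rule inj_onI, rule ext)
    fix \<psi> \<phi> n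
    assume *: "\<psi> \<in> odd_characters N" "\<phi> \<in> odd_characters N"
      "restrict \<psi> {0..<int N} = restrict \<phi> {0..<int N}"
    have "n mod int N \<in> {0..<int N}" using N by simp
    hence "\<psi> (n mod int N) = \<phi> (n mod int N)" using *(3) by (metis restrict_apply')
    thus "\<psi> n = \<phi> n" using per *(1,2) by (metis (mono_tags) mem_Collect_eq odd_characters_def)
  qed
  moreover have "(\<lambda>\<psi>. restrict \<psi> {0..<int N}) ` odd_characters N \<subseteq> {0..<int N} \<rightarrow>\<^sub>E V"
    using val by (auto simp: odd_characters_def)
  ultimately show ?thesis
    by (meson fin finite_PiE finite_atLeastLessThan_int finite_imageD finite_subset)
qed

end

(* Write Q = q^19 and let A(x) be the sum over n <> 0 of x^n / (1 - Q^n), for |Q| < |x| < 1. From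
   1/((1-U)(1-V)) = (1/(1-U) + 1/(1-V) - 1)/(1-UV) one reads off, comparing coefficients of
   x^m y^n, that A(x)A(y) - A(x)A(xy) - A(y)A(xy) is a sum of one-variable series in x, y and xy.
   Hence t_a = A(q^a) + 1/2 - a/19, an odd function of a mod 19, satisfies
     t_a t_b + t_a t_c + t_b t_c = W_a + W_b + W_c   whenever a + b + c = 19
   with an even function W of a mod 19.
   As L(0,chi) is the sum of chi(c)(1/2 - c/19), orthogonality of the odd characters expresses
   E_a through the t_b once L(0,chi) is inverted explicitly. The function
   s(a) = 1/2 - (a mod 19)/19 satisfies s(3c) + s(4c) + s(5c) + s(7c) = 1, -1 or 0 according as
   c = 1, c = -1 or neither mod 19, so the inverse of L(0,chi) is half the sum of the values of
   chi at the inverses 13, 5, 4, 11 of 3, 4, 5, 7, and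
     E_a = t_{3/a} + t_{4/a} + t_{5/a} + t_{7/a}   (division mod 19).
   The ten relations are then linear combinations of the relations for t in which W cancels. *)
theory Submission
  imports Defs
begin

no_notation Infinite_Set_Sum.abs_summable_on (infix \<open>abs'_summable'_on\<close> 50)

subsection \<open>Bilateral Lambert series\<close>

text \<open>The unshifted values A(q^a) are already odd, and their three-term sums already split
  into one-variable terms, but those terms change by A(q^a) under a -> 19 - a. The shift by 1/2 -
  a/19 makes W even, so that the W terms can be folded to the indices 1..9; it also absorbs the
  constant terms of the E_a. Classically, -(A + 1/2) is the Weierstrass zeta function in log x up to
  a multiple of log x, and the relation is the counterpart of (zeta(u) + zeta(v) + zeta(w))^2 =
  wp(u) + wp(v) + wp(w) for u + v + w = 0. The multipliers 3, 4, 5, 7 have sum 19. Hence for c prime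
  to 19 the residues of 3c, 4c, 5c, 7c add up to 19, 38 or 57, and the four values of s to 2 minus
  1, 2 or 3; the extreme cases occur only for c = 1 and c = -1. The point 0 lies outside the
  half-plane where the L-series is prescribed, so an actual continuation has to be built before
  L(0,chi) can be evaluated. The nonvanishing of L(0,chi) is then a by-product of its explicit
  inverse.\<close>

lemma abs_summable_on_Times_mult:
  fixes f :: "'a \<Rightarrow> complex" and g :: "'b \<Rightarrow> complex"
  assumes "f abs_summable_on A" "g abs_summable_on B"
  shows "(\<lambda>(x, y). f x * g y) abs_summable_on (A \<times> B)"
  unfolding Infinite_Sum.abs_summable_on_Sigma_iff
proof (intro conjI ballI)
  fix x assume "x \<in> A"
  show "(\<lambda>y. case (x, y) of (x, y) \<Rightarrow> f x * g y) abs_summable_on B"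
    using assms(2) by (simp add: norm_mult summable_on_cmult_right)
next
  have "(\<lambda>x. norm (f x) * (\<Sum>\<^sub>\<infinity>y\<in>B. norm (g y))) summable_on A"
    using assms(1) by (intro summable_on_cmult_left)
  thus "(\<lambda>x. \<Sum>\<^sub>\<infinity>y\<in>B. norm (case (x, y) of (x, y) \<Rightarrow> f x * g y)) abs_summable_on A"
    by (simp add: norm_mult infsum_cmult_right' abs_mult infsum_nonneg)
qed

lemma has_sum_Times_mult:
  fixes f :: "'a \<Rightarrow> complex" and g :: "'b \<Rightarrow> complex"
  assumes "f abs_summable_on A" "g abs_summable_on B"
  shows "((\<lambda>(x, y). f x * g y) has_sum (infsum f A * infsum g B)) (A \<times> B)"
proof (rule has_sum_SigmaI)
  show "((\<lambda>y. case (x, y) of (x, y) \<Rightarrow> f x * g y) has_sum f x * infsum g B) B" for x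
    using has_sum_cmult_right[OF has_sum_infsum[OF abs_summable_summable[OF assms(2)]]] by simp
  show "((\<lambda>x. f x * infsum g B) has_sum infsum f A * infsum g B) A"
    using has_sum_cmult_left[OF has_sum_infsum[OF abs_summable_summable[OF assms(1)]]] .
  show "(\<lambda>(x, y). f x * g y) summable_on A \<times> B"
    by (rule abs_summable_summable[OF abs_summable_on_Times_mult[OF assms]])
qed

text \<open>The value 0 at \<open>n = 0\<close> encodes the omission of that index, so that all sums
  can run over the whole group of integers and be reindexed freely.\<close>

definition lambert_coeff :: "complex \<Rightarrow> int \<Rightarrow> complex" where
  "lambert_coeff Q n = (if n = 0 then 0 else 1 / (1 - Q powi n))"

definition lambert_bilateral :: "complex \<Rightarrow> complex \<Rightarrow> complex" where
  "lambert_bilateral Q x = (\<Sum>\<^sub>\<infinity>n. lambert_coeff Q n * x powi n)"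

text \<open>Squares of coefficients arise on the diagonal m = n of the double series for a product,
  where the three-term identity between coefficients degenerates.\<close>

definition lambert_bilateral2 :: "complex \<Rightarrow> complex \<Rightarrow> complex" where
  "lambert_bilateral2 Q x = (\<Sum>\<^sub>\<infinity>n. lambert_coeff Q n ^ 2 * x powi n)"

lemma powi_neq_1:
  fixes Q :: complex
  assumes "Q \<noteq> 0" "norm Q < 1" "n \<noteq> 0"
  shows "Q powi n \<noteq> 1"
proof
  assume *: "Q powi n = 1"
  have "Q ^ nat \<bar>n\<bar> = 1"
  proof (cases "n \<ge> 0")
    case True thus ?thesis using * by (simp add: power_int_def)
  next
    case False thus ?thesis using * by (simp add: power_int_def power_inverse)
  qed
  hence "norm Q ^ nat \<bar>n\<bar> = 1" by (metis norm_one norm_power)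
  moreover have "norm Q ^ nat \<bar>n\<bar> < 1" using assms by (intro power_less_one_iff[THEN iffD2]) auto
  ultimately show False by simp
qed

lemma lambert_coeff_minus:
  assumes "Q \<noteq> 0" "norm Q < 1" "n \<noteq> 0"
  shows "lambert_coeff Q (-n) = 1 - lambert_coeff Q n"
proof -
  have "Q powi n \<noteq> 0" using assms by simp
  moreover have "Q powi n \<noteq> 1" "Q powi (-n) \<noteq> 1" using powi_neq_1[OF assms(1,2)] assms(3) by auto
  ultimately show ?thesis
    using assms by (simp add: lambert_coeff_def power_int_minus divide_simps) (simp add: algebra_simps)
qed

text \<open>This product form also covers \<open>n = 0\<close>, and it exhibits the decay of the
  coefficients at negative indices.\<close>

lemma lambert_coeff_minus_mult:
  assumes "Q \<noteq> 0" "norm Q < 1"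
  shows "lambert_coeff Q (-n) = - (Q powi n * lambert_coeff Q n)"
proof (cases "n = 0")
  case False
  have "Q powi n \<noteq> 0" using assms by simp
  moreover have "Q powi n \<noteq> 1" "Q powi (-n) \<noteq> 1" using powi_neq_1[OF assms] False by auto
  ultimately show ?thesis
    using False by (simp add: lambert_coeff_def power_int_minus divide_simps) (simp add: algebra_simps)
qed (simp add: lambert_coeff_def)

lemma lambert_coeff_mult:
  assumes "Q \<noteq> 0" "norm Q < 1" "m \<noteq> 0" "n \<noteq> 0" "m + n \<noteq> 0"
  shows "lambert_coeff Q m * lambert_coeff Q n = lambert_coeff Q (m + n) * (lambert_coeff Q m + lambert_coeff Q n - 1)"
proof -
  have "Q powi (m + n) = Q powi m * Q powi n" using assms by (simp add: power_int_add)
  moreover have "Q powi m \<noteq> 1" "Q powi n \<noteq> 1" "Q powi (m+n) \<noteq> 1"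
    using powi_neq_1[OF assms(1,2)] assms(3-5) by auto
  ultimately show ?thesis
    using assms by (simp add: lambert_coeff_def divide_simps) (simp add: algebra_simps)
qed

lemma norm_lambert_coeff_le:
  assumes "Q \<noteq> 0" "norm Q < 1"
  shows "norm (lambert_coeff Q n) \<le> 1 / (1 - norm Q)" "n \<ge> 0 \<Longrightarrow> norm (lambert_coeff Q (-n)) \<le> norm Q ^ nat n / (1 - norm Q)"
proof -
  have *: "norm (lambert_coeff Q n) \<le> 1 / (1 - norm Q)" if "n \<ge> 0" for n
  proof (cases "n = 0")
    case False
    have "norm Q ^ nat n \<le> norm Q ^ 1" using assms False that by (intro power_decreasing) auto
    moreover have "norm (1 - Q ^ nat n) \<ge> 1 - norm Q ^ nat n"
      by (metis norm_one norm_power norm_triangle_ineq2)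
    ultimately have "norm (1 - Q ^ nat n) \<ge> 1 - norm Q" by simp
    thus ?thesis using assms that False by (simp add: lambert_coeff_def power_int_def norm_divide frac_le)
  qed (use assms in \<open>auto simp: lambert_coeff_def\<close>)
  show **: "norm (lambert_coeff Q (-n)) \<le> norm Q ^ nat n / (1 - norm Q)" if "n \<ge> 0" for n
  proof -
    have "norm (lambert_coeff Q (-n)) = norm Q ^ nat n * norm (lambert_coeff Q n)"
      using that by (simp add: lambert_coeff_minus_mult[OF assms] norm_mult power_int_def norm_power)
    also have "\<dots> \<le> norm Q ^ nat n * (1 / (1 - norm Q))"
      by (intro mult_left_mono * that) auto
    finally show ?thesis by simp
  qed
  show "norm (lambert_coeff Q n) \<le> 1 / (1 - norm Q)"
  proof (cases "n \<ge> 0")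
    case False
    have "norm (lambert_coeff Q n) \<le> norm Q ^ nat (-n) / (1 - norm Q)" using **[of "-n"] False by simp
    also have "\<dots> \<le> 1 / (1 - norm Q)"
      using assms by (intro divide_right_mono power_le_one) auto
    finally show ?thesis .
  qed (use * in auto)
qed

lemma summable_on_int_geometric:
  fixes r s :: real
  assumes "0 \<le> r" "r < 1" "0 \<le> s" "s < 1"
  shows "(\<lambda>n::int. if n \<ge> 0 then r ^ nat n else s ^ nat (-n)) summable_on UNIV"
proof -
  have g: "(\<lambda>n. c ^ n) summable_on (UNIV :: nat set)" if "0 \<le> c" "c < 1" for c :: real
    using that by (subst summable_on_UNIV_nonneg_real_iff) (auto simp: summable_geometric)
  have "(\<lambda>n::int. r ^ nat n) summable_on {0..}"
    using g[OF assms(1,2)]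
    by (subst summable_on_reindex_bij_witness[where T = UNIV and i = int and j = nat and h = "\<lambda>n. r ^ n"]) auto
  hence 1: "(\<lambda>n::int. if n \<ge> 0 then r ^ nat n else s ^ nat (-n)) summable_on {0..}"
    by (rule summable_on_cong[THEN iffD1, rotated]) auto
  have "(\<lambda>n. s ^ n) summable_on {0<..}"
    using g[OF assms(3,4)] by (rule summable_on_subset_banach) auto
  hence "(\<lambda>n::int. s ^ nat (-n)) summable_on {..<0}"
    by (subst summable_on_reindex_bij_witness[where T = "{0<..}" and i = "\<lambda>n. - int n" and j = "\<lambda>n. nat (-n)" and h = "\<lambda>n. s ^ n"]) auto
  hence 2: "(\<lambda>n::int. if n \<ge> 0 then r ^ nat n else s ^ nat (-n)) summable_on {..<0}"
    by (rule summable_on_cong[THEN iffD1, rotated]) auto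
  have "{0..} \<union> {..<0} = (UNIV :: int set)" by auto
  moreover have "{0..} \<inter> {..<0::int} = {}" by auto
  ultimately show ?thesis using summable_on_Un_disjoint[OF 1 2] by simp
qed

text \<open>The majorant is geometric on both sides, with ratio |x| at positive and |Q|/|x| at
  negative indices; this is where the annulus |Q| < |x| < 1 comes from. A general \<open>f\<close>
  serves the coefficients and their squares alike.\<close>

lemma abs_summable_lambert_dominated:
  fixes f :: "int \<Rightarrow> complex"
  assumes "Q \<noteq> 0" "norm Q < norm x" "norm x < 1" and C: "C \<ge> 0" and "\<And>n. norm (f n) \<le> C * norm (lambert_coeff Q n)"
  shows "(\<lambda>n. f n * x powi n) abs_summable_on UNIV"
proof (rule Infinite_Sum.abs_summable_on_comparison_test')
  let ?D = "C / (1 - norm Q)"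
  have Q: "norm Q < 1" using assms by linarith
  show "(\<lambda>n::int. ?D * (if n \<ge> 0 then norm x ^ nat n else (norm Q / norm x) ^ nat (-n))) summable_on UNIV"
    using assms Q by (intro summable_on_cmult_right summable_on_int_geometric)
      (auto simp: divide_less_eq)
  fix n :: int
  have "norm (f n * x powi n) \<le> C * norm (lambert_coeff Q n) * norm x powi n"
    unfolding norm_mult norm_power_int by (intro mult_right_mono assms(5)) auto
  also have "\<dots> \<le> ?D * (if n \<ge> 0 then norm x ^ nat n else (norm Q / norm x) ^ nat (-n))"
  proof (cases "n \<ge> 0")
    case True
    have "C * norm (lambert_coeff Q n) * norm x powi n \<le> C * (1 / (1 - norm Q)) * norm x powi n"
      by (intro mult_right_mono mult_left_mono norm_lambert_coeff_le assms Q C) auto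
    thus ?thesis using True by (simp add: power_int_def)
  next
    case False
    have "C * norm (lambert_coeff Q n) * norm x powi n \<le> C * (norm Q ^ nat (-n) / (1 - norm Q)) * norm x powi n"
      using norm_lambert_coeff_le(2)[of Q "-n"] False assms Q C by (intro mult_right_mono mult_left_mono) auto
    moreover have "norm x powi n = inverse (norm x ^ nat (-n))"
      using False by (simp add: power_int_def power_inverse)
    ultimately show ?thesis using False by (simp add: divide_inverse mult_ac power_mult_distrib power_inverse)
  qed
  finally show "norm (f n * x powi n) \<le> ?D * (if n \<ge> 0 then norm x ^ nat n else (norm Q / norm x) ^ nat (-n))" .
qed

lemma abs_summable_lambert_coeff:
  assumes "Q \<noteq> 0" "norm Q < norm x" "norm x < 1"
  shows "(\<lambda>n. lambert_coeff Q n * x powi n) abs_summable_on UNIV"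
  by (rule abs_summable_lambert_dominated[where C = 1]) (use assms in auto)

lemma abs_summable_lambert_coeff2:
  assumes "Q \<noteq> 0" "norm Q < norm x" "norm x < 1"
  shows "(\<lambda>n. lambert_coeff Q n ^ 2 * x powi n) abs_summable_on UNIV"
proof (rule abs_summable_lambert_dominated[where C = "1 / (1 - norm Q)"])
  fix n :: int
  show "norm ((lambert_coeff Q n)\<^sup>2) \<le> 1 / (1 - norm Q) * norm (lambert_coeff Q n)"
    using norm_lambert_coeff_le(1)[of Q n] assms unfolding power2_eq_square norm_mult
    by (intro mult_right_mono) auto
qed (use assms in auto)

lemma has_sum_lambert_bilateral:
  assumes "Q \<noteq> 0" "norm Q < norm x" "norm x < 1"
  shows "((\<lambda>n. lambert_coeff Q n * x powi n) has_sum lambert_bilateral Q x) UNIV"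
    and "((\<lambda>n. lambert_coeff Q n ^ 2 * x powi n) has_sum lambert_bilateral2 Q x) UNIV"
  using abs_summable_summable[OF abs_summable_lambert_coeff[OF assms]]
        abs_summable_summable[OF abs_summable_lambert_coeff2[OF assms]]
  by (auto simp: lambert_bilateral_def lambert_bilateral2_def)

lemma has_sum_diff:
  fixes f g :: "'a \<Rightarrow> complex"
  assumes "(f has_sum S) A" "(g has_sum T) A"
  shows "((\<lambda>x. f x - g x) has_sum (S - T)) A"
  using has_sum_add[OF assms(1) has_sum_uminusI[OF assms(2)]] by simp

text \<open>Replace n by -n. The factor Q^(-n) coming from (Q/x)^(-n) is absorbed by one coefficient
  through \<open>lambert_coeff_minus_mult\<close>. In the squared series the second coefficient
  becomes 1 - u, which produces the extra term.\<close>

lemma lambert_bilateral_reflect: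
  assumes "Q \<noteq> 0" "norm Q < norm x" "norm x < 1"
  shows "lambert_bilateral Q (Q / x) = - lambert_bilateral Q x" "lambert_bilateral2 Q (Q / x) = lambert_bilateral2 Q x - lambert_bilateral Q x"
proof -
  have [simp]: "x \<noteq> 0" and Q: "norm Q < 1" using assms by auto
  have y: "norm Q < norm (Q / x)" "norm (Q / x) < 1"
    using assms by (auto simp: norm_divide field_simps)
  have pw: "(Q / x) powi (- n) = x powi n / Q powi n" for n
    by (simp add: power_int_divide_distrib power_int_minus field_simps)
  have "((\<lambda>n. lambert_coeff Q (-n) * (Q / x) powi (-n)) has_sum lambert_bilateral Q (Q / x)) UNIV"
    using has_sum_lambert_bilateral(1)[OF assms(1) y]
    by (subst has_sum_reindex_bij_witness[where T = UNIV and i = uminus and j = uminus and h = "\<lambda>n. lambert_coeff Q n * (Q / x) powi n"]) auto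
  also have "(\<lambda>n. lambert_coeff Q (-n) * (Q / x) powi (-n)) = (\<lambda>n. - (lambert_coeff Q n * x powi n))"
    unfolding pw lambert_coeff_minus_mult[OF assms(1) Q] using assms(1) by auto
  finally show "lambert_bilateral Q (Q / x) = - lambert_bilateral Q x"
    using has_sum_unique has_sum_uminusI[OF has_sum_lambert_bilateral(1)[OF assms]] by blast
  have "((\<lambda>n. lambert_coeff Q (-n) ^ 2 * (Q / x) powi (-n)) has_sum lambert_bilateral2 Q (Q / x)) UNIV"
    using has_sum_lambert_bilateral(2)[OF assms(1) y]
    by (subst has_sum_reindex_bij_witness[where T = UNIV and i = uminus and j = uminus and h = "\<lambda>n. lambert_coeff Q n ^ 2 * (Q / x) powi n"]) auto
  also have "(\<lambda>n. lambert_coeff Q (-n) ^ 2 * (Q / x) powi (-n)) = (\<lambda>n. lambert_coeff Q n ^ 2 * x powi n - lambert_coeff Q n * x powi n)"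
  proof
    fix n
    show "lambert_coeff Q (-n) ^ 2 * (Q / x) powi (-n) = lambert_coeff Q n ^ 2 * x powi n - lambert_coeff Q n * x powi n"
    proof (cases "n = 0")
      case False
      have "lambert_coeff Q (-n) ^ 2 * (Q / x) powi (-n) = lambert_coeff Q (-n) * (lambert_coeff Q (-n) * (Q / x) powi (-n))"
        by (simp add: power2_eq_square)
      also have "lambert_coeff Q (-n) * (Q / x) powi (-n) = - (lambert_coeff Q n * x powi n)"
        unfolding pw lambert_coeff_minus_mult[OF assms(1) Q] using assms(1) by auto
      also have "lambert_coeff Q (-n) * \<dots> = lambert_coeff Q n ^ 2 * x powi n - lambert_coeff Q n * x powi n"
        by (simp add: lambert_coeff_minus[OF assms(1) Q False] algebra_simps power2_eq_square)
      finally show ?thesis .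
    qed (simp add: lambert_coeff_def)
  qed
  finally show "lambert_bilateral2 Q (Q / x) = lambert_bilateral2 Q x - lambert_bilateral Q x"
    using has_sum_unique has_sum_diff[OF has_sum_lambert_bilateral(2)[OF assms] has_sum_lambert_bilateral(1)[OF assms]] by blast
qed

text \<open>Partial fractions for the indices m - n and n, combined with u(n - m) = 1 - u(m - n).
  The excluded lines m = 0, n = 0 and m = n are those from which the one-variable series will
  come.\<close>

lemma lambert_coeff_three_term:
  assumes "Q \<noteq> 0" "norm Q < 1" "m \<noteq> 0" "n \<noteq> 0" "m \<noteq> n"
  shows "lambert_coeff Q m * lambert_coeff Q n = lambert_coeff Q (m - n) * lambert_coeff Q n + lambert_coeff Q m * lambert_coeff Q (n - m)"
proof -
  have "lambert_coeff Q (m - n) * lambert_coeff Q n = lambert_coeff Q m * (lambert_coeff Q (m - n) + lambert_coeff Q n - 1)"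
    using lambert_coeff_mult[OF assms(1,2), of "m - n" n] assms by simp
  moreover have eq: "lambert_coeff Q (n - m) = 1 - lambert_coeff Q (m - n)"
    using lambert_coeff_minus[OF assms(1,2), of "m - n"] assms by simp
  ultimately show ?thesis unfolding eq by (simp add: algebra_simps)
qed

text \<open>All three products become double series in x^m y^n, since x^j (xy)^k = x^(j+k) y^k and
  y^j (xy)^k = x^k y^(j+k). Off the lines m = 0, n = 0, m = n the coefficients cancel by the
  three-term identity; the right-hand side collects what remains on these lines. The hypotheses
  place x, y and xy in the annulus of absolute convergence.\<close>

lemma lambert_bilateral_mult:
  assumes Q: "Q \<noteq> 0" and xy: "norm Q < norm (x * y)" and x: "norm x < 1" and y: "norm y < 1"
  shows "lambert_bilateral Q x * lambert_bilateral Q y - lambert_bilateral Q x * lambert_bilateral Q (x * y) - lambert_bilateral Q y * lambert_bilateral Q (x * y) =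
           lambert_bilateral2 Q (x * y) + (lambert_bilateral2 Q x - lambert_bilateral Q x) + (lambert_bilateral2 Q y - lambert_bilateral Q y)"
proof -
  have nz: "x \<noteq> 0" "y \<noteq> 0" using xy by auto
  have lt: "norm (x * y) < norm x" "norm (x * y) < norm y"
    using x y nz by (auto simp: norm_mult)
  have Q1: "norm Q < 1" using xy lt x by linarith
  have dx: "norm Q < norm x" and dy: "norm Q < norm y" and dxy: "norm (x * y) < 1"
    using xy lt x by linarith+
  note sx = abs_summable_lambert_coeff[OF Q dx x] and sy = abs_summable_lambert_coeff[OF Q dy y]
    and sxy = abs_summable_lambert_coeff[OF Q xy dxy]
  define u where "u = lambert_coeff Q"
  have pw: "z powi (j + k) = z powi j * z powi k" if "z \<noteq> 0" for z :: complex and j k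
    using that by (simp add: power_int_add)
  have 1: "((\<lambda>(m,n). u m * u n * x powi m * y powi n) has_sum lambert_bilateral Q x * lambert_bilateral Q y) UNIV"
    using has_sum_Times_mult[OF sx sy]
    by (simp add: lambert_bilateral_def u_def mult_ac)
  have "((\<lambda>(j,k). u j * x powi j * (u k * (x * y) powi k)) has_sum lambert_bilateral Q x * lambert_bilateral Q (x * y)) UNIV"
    using has_sum_Times_mult[OF sx sxy] by (simp add: lambert_bilateral_def u_def)
  also have "?this \<longleftrightarrow> ((\<lambda>(m,n). u (m - n) * u n * x powi m * y powi n) has_sum lambert_bilateral Q x * lambert_bilateral Q (x * y)) UNIV"
    by (rule has_sum_reindex_bij_witness[where i = "\<lambda>(m,n). (m - n, n)" and j = "\<lambda>(j,k). (j + k, k)"])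
       (auto simp: pw nz power_int_mult_distrib mult_ac)
  finally have 2: "((\<lambda>(m,n). u (m - n) * u n * x powi m * y powi n) has_sum lambert_bilateral Q x * lambert_bilateral Q (x * y)) UNIV" .
  have "((\<lambda>(j,k). u j * y powi j * (u k * (x * y) powi k)) has_sum lambert_bilateral Q y * lambert_bilateral Q (x * y)) UNIV"
    using has_sum_Times_mult[OF sy sxy] by (simp add: lambert_bilateral_def u_def)
  also have "?this \<longleftrightarrow> ((\<lambda>(m,n). u m * u (n - m) * x powi m * y powi n) has_sum lambert_bilateral Q y * lambert_bilateral Q (x * y)) UNIV"
    by (rule has_sum_reindex_bij_witness[where i = "\<lambda>(m,n). (n - m, m)" and j = "\<lambda>(j,k). (k, j + k)"])
       (auto simp: pw nz power_int_mult_distrib mult_ac)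
  finally have 3: "((\<lambda>(m,n). u m * u (n - m) * x powi m * y powi n) has_sum lambert_bilateral Q y * lambert_bilateral Q (x * y)) UNIV" .
  \<comment> \<open>A series over the integers is transported to a line in the integer plane and
    extended by zero, so that the remaining terms can be compared coefficientwise with the double
    series.\<close>
  have emb: "((\<lambda>p. if p \<in> T then f (i p) else 0) has_sum S) UNIV"
    if "(f has_sum S) UNIV" "\<And>n. j n \<in> T" "\<And>n. i (j n) = n" "\<And>p. p \<in> T \<Longrightarrow> j (i p) = p"
    for j :: "int \<Rightarrow> int \<times> int" and f :: "int \<Rightarrow> complex" and S T i
  proof -
    have "(f has_sum S) UNIV \<longleftrightarrow> ((\<lambda>p. f (i p)) has_sum S) T"
      by (rule has_sum_reindex_bij_witness[where i = i and j = j]) (use that in auto)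
    also have "\<dots> \<longleftrightarrow> ((\<lambda>p. if p \<in> T then f (i p) else 0) has_sum S) UNIV"
      by (rule has_sum_cong_neutral) auto
    finally show ?thesis using that(1) by simp
  qed
  note hxy = has_sum_lambert_bilateral(2)[OF Q xy dxy]
  have hx: "((\<lambda>n. lambert_coeff Q n ^ 2 * x powi n - lambert_coeff Q n * x powi n) has_sum lambert_bilateral2 Q x - lambert_bilateral Q x) UNIV"
    by (intro has_sum_diff has_sum_lambert_bilateral Q dx x)
  have hy: "((\<lambda>n. lambert_coeff Q n ^ 2 * y powi n - lambert_coeff Q n * y powi n) has_sum lambert_bilateral2 Q y - lambert_bilateral Q y) UNIV"
    by (intro has_sum_diff has_sum_lambert_bilateral Q dy y)
  have "((\<lambda>p. if p \<in> {(m,n). m = n} then lambert_coeff Q (fst p) ^ 2 * (x * y) powi fst p else 0) has_sum lambert_bilateral2 Q (x * y)) UNIV"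
    by (rule emb[OF hxy, where j = "\<lambda>n. (n, n)" and i = fst and T = "{(m,n). m = n}"]) auto
  also have "(\<lambda>p. if p \<in> {(m,n). m = n} then lambert_coeff Q (fst p) ^ 2 * (x * y) powi fst p else 0) =
      (\<lambda>(m,n). if m = n then u n ^ 2 * (x * y) powi n else 0)"
    by (auto simp: u_def)
  finally have e1: "(\<dots> has_sum lambert_bilateral2 Q (x * y)) UNIV" .
  have "((\<lambda>p. if p \<in> {(m,n). n = (0::int)} then lambert_coeff Q (fst p) ^ 2 * x powi fst p - lambert_coeff Q (fst p) * x powi fst p else 0)
      has_sum lambert_bilateral2 Q x - lambert_bilateral Q x) UNIV"
    by (rule emb[OF hx, where j = "\<lambda>n. (n, 0)" and i = fst and T = "{(m,n). n = (0::int)}"]) auto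
  also have "(\<lambda>p. if p \<in> {(m,n). n = (0::int)} then lambert_coeff Q (fst p) ^ 2 * x powi fst p - lambert_coeff Q (fst p) * x powi fst p else 0) =
      (\<lambda>(m,n). if n = 0 then u m ^ 2 * x powi m - u m * x powi m else 0)"
    by (auto simp: u_def)
  finally have e2: "(\<dots> has_sum lambert_bilateral2 Q x - lambert_bilateral Q x) UNIV" .
  have "((\<lambda>p. if p \<in> {(m,n). m = (0::int)} then lambert_coeff Q (snd p) ^ 2 * y powi snd p - lambert_coeff Q (snd p) * y powi snd p else 0)
      has_sum lambert_bilateral2 Q y - lambert_bilateral Q y) UNIV"
    by (rule emb[OF hy, where j = "\<lambda>n. (0, n)" and i = snd and T = "{(m,n). m = (0::int)}"]) auto
  also have "(\<lambda>p. if p \<in> {(m,n). m = (0::int)} then lambert_coeff Q (snd p) ^ 2 * y powi snd p - lambert_coeff Q (snd p) * y powi snd p else 0) =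
      (\<lambda>(m,n). if m = 0 then u n ^ 2 * y powi n - u n * y powi n else 0)"
    by (auto simp: u_def)
  finally have e3: "(\<dots> has_sum lambert_bilateral2 Q y - lambert_bilateral Q y) UNIV" .
  have "((\<lambda>(m,n). (u m * u n * x powi m * y powi n - u (m - n) * u n * x powi m * y powi n) -
           u m * u (n - m) * x powi m * y powi n) has_sum
         lambert_bilateral Q x * lambert_bilateral Q y - lambert_bilateral Q x * lambert_bilateral Q (x * y) - lambert_bilateral Q y * lambert_bilateral Q (x * y)) UNIV"
    using has_sum_diff[OF has_sum_diff[OF 1 2] 3] by (simp add: case_prod_unfold)
  also have "(\<lambda>(m,n). (u m * u n * x powi m * y powi n - u (m - n) * u n * x powi m * y powi n) -
           u m * u (n - m) * x powi m * y powi n) =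
     (\<lambda>(m,n). (if m = n then u n ^ 2 * (x * y) powi n else 0) +
              (if n = 0 then u m ^ 2 * x powi m - u m * x powi m else 0) +
              (if m = 0 then u n ^ 2 * y powi n - u n * y powi n else 0))"
  proof (intro ext, clarify)
    fix m n :: int
    have u0: "u 0 = 0" by (simp add: u_def lambert_coeff_def)
    \<comment> \<open>The three lines meet only at the origin, where \<open>u 0 = 0\<close>
      annihilates every term, so their overlap does no harm.\<close>
    consider "m = 0" "n = 0" | "m = 0" "n \<noteq> 0" | "m \<noteq> 0" "n = 0" | "m \<noteq> 0" "n \<noteq> 0" "m = n" | "m \<noteq> 0" "n \<noteq> 0" "m \<noteq> n"
      by blast
    thus "(u m * u n * x powi m * y powi n - u (m - n) * u n * x powi m * y powi n) -
           u m * u (n - m) * x powi m * y powi n = (if m = n then u n ^ 2 * (x * y) powi n else 0) +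
              (if n = 0 then u m ^ 2 * x powi m - u m * x powi m else 0) +
              (if m = 0 then u n ^ 2 * y powi n - u n * y powi n else 0)"
    proof cases
      case 2
      hence eq: "u (-n) = 1 - u n" using lambert_coeff_minus[OF Q Q1] by (simp add: u_def)
      show ?thesis using 2 u0 by (simp add: eq) (simp add: algebra_simps power2_eq_square)
    next
      case 3
      hence eq: "u (-m) = 1 - u m" using lambert_coeff_minus[OF Q Q1] by (simp add: u_def)
      show ?thesis using 3 u0 by (simp add: eq) (simp add: algebra_simps power2_eq_square)
    next
      case 4 thus ?thesis using u0 by (simp add: power2_eq_square power_int_mult_distrib)
    next
      case 5
      have "u m * u n = u (m - n) * u n + u m * u (n - m)"
        using lambert_coeff_three_term[OF Q Q1] 5 by (simp add: u_def)
      hence "(u m * u n - u (m - n) * u n - u m * u (n - m)) * (x powi m * y powi n) = 0"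
        by simp
      thus ?thesis using 5 by (simp add: ring_distribs mult.assoc)
    qed (use u0 in auto)
  qed
  finally have L: "((\<lambda>(m,n). (if m = n then u n ^ 2 * (x * y) powi n else 0) +
              (if n = 0 then u m ^ 2 * x powi m - u m * x powi m else 0) +
              (if m = 0 then u n ^ 2 * y powi n - u n * y powi n else 0)) has_sum
         lambert_bilateral Q x * lambert_bilateral Q y - lambert_bilateral Q x * lambert_bilateral Q (x * y) - lambert_bilateral Q y * lambert_bilateral Q (x * y)) UNIV" .
  have "((\<lambda>(m,n). (if m = n then u n ^ 2 * (x * y) powi n else 0) +
              (if n = 0 then u m ^ 2 * x powi m - u m * x powi m else 0) +
              (if m = 0 then u n ^ 2 * y powi n - u n * y powi n else 0)) has_sum
         lambert_bilateral2 Q (x * y) + (lambert_bilateral2 Q x - lambert_bilateral Q x) + (lambert_bilateral2 Q y - lambert_bilateral Q y)) UNIV"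
    using has_sum_add[OF has_sum_add[OF e1 e2] e3] by (simp add: case_prod_unfold)
  thus ?thesis using L has_sum_unique by blast
qed

subsection \<open>Periodic Dirichlet series at zero\<close>

text \<open>Summation by parts against the partial sums of a periodic mean-zero sequence, recentred to
  mean zero, can be iterated; each step gains one power of \<open>n\<close> in the convergence of
  \<open>\<Sum>n. u n / n powr s\<close>, and at \<open>s = 0\<close> only the first boundary term survives.\<close>

definition partial_mean :: "nat \<Rightarrow> (nat \<Rightarrow> complex) \<Rightarrow> complex" where
  "partial_mean N u = (\<Sum>n<N. \<Sum>k\<le>n. u k) / of_nat N"

definition centred_sums :: "nat \<Rightarrow> (nat \<Rightarrow> complex) \<Rightarrow> nat \<Rightarrow> complex" where
  "centred_sums N u n = (\<Sum>k\<le>n. u k) - partial_mean N u"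

definition mean_zero :: "nat \<Rightarrow> (nat \<Rightarrow> complex) \<Rightarrow> bool" where
  "mean_zero N u \<longleftrightarrow> (\<forall>n. u (n + N) = u n) \<and> (\<Sum>n<N. u n) = 0"

lemma mean_zero_bounded:
  assumes "mean_zero N u" "N > 0"
  obtains V where "V > 0" "\<And>n. norm (u n) \<le> V"
proof -
  define V where "V = 1 + (\<Sum>n<N. norm (u n))"
  have "norm (u n) \<le> V" for n
  proof (induction n rule: less_induct)
    case (less n)
    show ?case
    proof (cases "n < N")
      case True
      have "norm (u n) \<le> (\<Sum>n<N. norm (u n))" using True by (intro member_le_sum) auto
      thus ?thesis by (simp add: V_def)
    next
      case False
      have "u n = u (n - N)" using assms(1) False unfolding mean_zero_def
        by (metis le_add_diff_inverse2 not_less)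
      thus ?thesis using less.IH[of "n - N"] False assms(2) by simp
    qed
  qed
  moreover have "V > 0" by (auto simp: V_def intro!: add_pos_nonneg sum_nonneg)
  ultimately show ?thesis using that by blast
qed

lemma mean_zero_centred_sums:
  assumes "mean_zero N u" "N > 0"
  shows "mean_zero N (centred_sums N u)"
proof -
  have per: "u (n + N) = u n" for n using assms by (simp add: mean_zero_def)
  have z: "(\<Sum>k<N. u k) = 0" using assms by (simp add: mean_zero_def)
  have "(\<Sum>k\<le>n + N. u k) = (\<Sum>k\<le>n. u k)" for n
  proof -
    have "(\<Sum>k\<le>n + N. u k) = (\<Sum>k<N. u k) + (\<Sum>k=N..n+N. u k)"
      by (subst sum.union_disjoint[symmetric]) (auto intro!: sum.cong)
    also have "(\<Sum>k=N..n+N. u k) = (\<Sum>k\<le>n. u (k + N))"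
      by (rule sum.reindex_bij_witness[of _ "\<lambda>k. k + N" "\<lambda>k. k - N"]) auto
    finally show ?thesis by (simp add: per z)
  qed
  thus ?thesis using assms(2)
    by (simp add: mean_zero_def centred_sums_def sum_subtractf partial_mean_def)
qed

lemma mean_zero_funpow:
  assumes "mean_zero N u" "N > 0"
  shows "mean_zero N ((centred_sums N ^^ m) u)"
  by (induction m) (auto intro: assms mean_zero_centred_sums)

text \<open>Abel summation with each partial sum split into its centred part and the constant
  \<open>partial_mean N u\<close>. The constant part telescopes to the term at \<open>g 0\<close>,
  and the boundary term vanishes in the limit because the partial sums are bounded and
  \<open>g\<close> tends to 0.\<close>

lemma sums_by_parts:
  assumes u: "mean_zero N u" "N > 0" and g: "g \<longlonglongrightarrow> 0"
    and S: "(\<lambda>n. centred_sums N u n * (g n - g (Suc n))) sums S"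
  shows "(\<lambda>n. u n * g n) sums (partial_mean N u * g 0 + S)"
proof -
  let ?c = "partial_mean N u"
  have eq: "(\<Sum>n<M. u n * g n) = (\<Sum>n<M. centred_sums N u n * (g n - g (Suc n))) +
      ?c * (g 0 - g M) + (\<Sum>k<M. u k) * g M" for M
  proof (induction M)
    case (Suc M)
    have "(\<Sum>k\<le>M. u k) = (\<Sum>k<M. u k) + u M"
      by (metis lessThan_Suc_atMost sum.lessThan_Suc)
    hence "centred_sums N u M = (\<Sum>k<M. u k) + u M - ?c" by (simp add: centred_sums_def)
    thus ?case by (simp only: sum.lessThan_Suc Suc.IH) (simp add: algebra_simps)
  qed simp
  obtain V where V: "V > 0" "\<And>n. norm (centred_sums N u n) \<le> V"
    using mean_zero_bounded[OF mean_zero_centred_sums[OF u] u(2)] by blast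
  have bdd: "norm (\<Sum>k<M. u k) \<le> V + norm ?c" for M
  proof (cases M)
    case (Suc n)
    have "(\<Sum>k<M. u k) = centred_sums N u n + ?c"
      by (simp add: centred_sums_def Suc lessThan_Suc_atMost)
    thus ?thesis using V(2)[of n] norm_triangle_ineq[of "centred_sums N u n" ?c] by simp
  qed (use V(1) in simp)
  have "(\<lambda>M. (\<Sum>k<M. u k) * g M) \<longlonglongrightarrow> 0"
  proof (rule Lim_null_comparison)
    show "\<forall>\<^sub>F M in sequentially. norm ((\<Sum>k<M. u k) * g M) \<le> (V + norm ?c) * norm (g M)"
      by (intro always_eventually allI) (simp add: norm_mult mult_right_mono bdd)
    show "(\<lambda>M. (V + norm ?c) * norm (g M)) \<longlonglongrightarrow> 0"
      using tendsto_mult_right_zero[OF tendsto_norm_zero[OF g]] .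
  qed
  moreover have "(\<lambda>M. ?c * (g 0 - g M)) \<longlonglongrightarrow> ?c * (g 0 - 0)"
    by (intro tendsto_intros g)
  ultimately have "(\<lambda>M. (\<Sum>n<M. centred_sums N u n * (g n - g (Suc n))) +
      ?c * (g 0 - g M) + (\<Sum>k<M. u k) * g M) \<longlonglongrightarrow> S + ?c * (g 0 - 0) + 0"
    using S unfolding sums_def by (intro tendsto_add)
  thus ?thesis unfolding sums_def eq by (simp add: add_ac)
qed

section \<open>Iterated differences of complex powers in the base\<close>

fun powr_diff :: "nat \<Rightarrow> complex \<Rightarrow> complex \<Rightarrow> complex" where
  "powr_diff 0 z s = z powr (-s)"
| "powr_diff (Suc m) z s = powr_diff m z s - powr_diff m (z + 1) s"

text \<open>Differentiation in z commutes with differencing and raises the exponent s to s + 1. This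
  drives the induction for the decay estimate.\<close>

lemma has_field_derivative_powr_diff:
  assumes "Re z > 0"
  shows "((\<lambda>z. powr_diff m z s) has_field_derivative - s * powr_diff m z (s + 1)) (at z within A)"
  using assms
proof (induction m arbitrary: z A)
  case 0
  hence "z \<notin> \<real>\<^sub>\<le>\<^sub>0" by (auto simp: complex_nonpos_Reals_iff)
  from has_field_derivative_powr[OF this, of "-s"] show ?case
    by (simp add: has_field_derivative_at_within)
next
  case (Suc m)
  have "((\<lambda>z. powr_diff m (z + 1) s) has_field_derivative - s * powr_diff m (z + 1) (s + 1)) (at z)"
    using DERIV_shift[of "\<lambda>z. powr_diff m z s" "- s * powr_diff m (z + 1) (s + 1)" z 1] Suc.IH[of "z + 1" UNIV] Suc.prems
    by simp
  hence "((\<lambda>z. powr_diff m (z + 1) s) has_field_derivative - s * powr_diff m (z + 1) (s + 1)) (at z within A)"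
    by (rule has_field_derivative_at_within)
  from DERIV_diff[OF Suc.IH[OF Suc.prems] this] show ?case
    by (simp add: algebra_simps)
qed

lemma holomorphic_powr_diff: "Re z > 0 \<Longrightarrow> (\<lambda>s. powr_diff m z s) holomorphic_on A"
proof (induction m arbitrary: z)
  case 0
  hence "z \<noteq> 0" by auto
  thus ?case by (auto intro!: holomorphic_intros)
next
  case (Suc m)
  have "(\<lambda>s. powr_diff m z s - powr_diff m (z + 1) s) holomorphic_on A"
    using Suc.prems by (intro holomorphic_on_diff Suc.IH) auto
  thus ?case by simp
qed

text \<open>A difference over a unit step is bounded by the derivative on the segment, which is -s
  times the difference of one order less at s + 1. Each order thus gains one power of x at the cost
  of one factor of the rising factorial of s. The condition on \<open>Re s + m\<close> makes the
  bounding power nonincreasing along the segment.\<close>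

lemma norm_powr_diff_le:
  assumes "x > 0" "Re s + m \<ge> 0"
  shows "norm (powr_diff m (of_real x) s) \<le> (\<Prod>j<m. norm (s + of_nat j)) * x powr (-(Re s + m))"
  using assms
proof (induction m arbitrary: x s)
  case 0
  thus ?case by (simp add: norm_powr_real_powr)
next
  case (Suc m)
  let ?P = "\<Prod>j<m. norm (s + 1 + of_nat j)"
  let ?B = "norm s * (?P * x powr (-(Re s + Suc m)))"
  have "norm (powr_diff m (of_real x) s - powr_diff m (of_real (x + 1)) s) \<le> ?B * norm (complex_of_real x - of_real (x + 1))"
  proof (rule field_differentiable_bound)
    fix z assume "z \<in> closed_segment (complex_of_real x) (of_real (x + 1))"
    hence "z \<in> of_real ` closed_segment x (x + 1)" by (simp only: closed_segment_of_real)
    then obtain t where t: "z = of_real t" "x \<le> t" by (auto simp: closed_segment_eq_real_ivl)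
    show "((\<lambda>z. powr_diff m z s) has_field_derivative - s * powr_diff m z (s + 1)) (at z within closed_segment (of_real x) (of_real (x + 1)))"
      using t Suc.prems by (intro has_field_derivative_powr_diff) auto
    have "norm (powr_diff m z (s + 1)) \<le> ?P * t powr (-(Re (s + 1) + m))"
      unfolding t(1) using Suc.prems t by (intro Suc.IH) auto
    also have "\<dots> \<le> ?P * x powr (-(Re s + Suc m))"
      using Suc.prems t by (intro mult_left_mono prod_nonneg) (auto intro!: powr_mono2' simp: add_ac)
    finally show "norm (- s * powr_diff m z (s + 1)) \<le> ?B"
      by (simp add: norm_mult mult_left_mono)
  qed auto
  also have "?B * norm (complex_of_real x - of_real (x + 1)) = ?B" by simp
  also have "norm s * (?P * x powr (-(Re s + Suc m))) = (\<Prod>j<Suc m. norm (s + of_nat j)) * x powr (-(Re s + Suc m))"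
    by (simp only: prod.lessThan_Suc_shift) (simp add: add_ac)
  finally show ?case by simp
qed

lemma powr_diff_at_0: "powr_diff m z 0 = (if m = 0 then (if z = 0 then 0 else 1) else 0)"
  if "Re z > 0"
  using that
proof (induction m arbitrary: z)
  case (Suc m)
  thus ?case by (cases "z + 1 = 0") (auto simp: complex_eq_iff)
qed auto

text \<open>The bound depends on s only through R and \<sigma>, which is the uniformity that the
  Weierstrass test requires.\<close>

lemma norm_powr_diff_le':
  assumes "norm s \<le> R" "\<sigma> \<le> Re s" "0 \<le> \<sigma> + m"
  shows "norm (powr_diff m (of_nat (Suc n)) s) \<le> (R + m) ^ m * of_nat (Suc n) powr (-(\<sigma> + m))"
proof -
  have R: "R \<ge> 0" using assms(1) norm_ge_zero[of s] by linarith
  have "norm (powr_diff m (of_real (real (Suc n))) s) \<le>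
      (\<Prod>j<m. norm (s + of_nat j)) * real (Suc n) powr (-(Re s + m))"
    using assms by (intro norm_powr_diff_le) auto
  also have "\<dots> \<le> (\<Prod>j<m. R + m) * real (Suc n) powr (-(\<sigma> + m))"
  proof (intro mult_mono prod_mono conjI powr_mono prod_nonneg)
    fix j assume "j \<in> {..<m}"
    thus "norm (s + of_nat j) \<le> R + m"
      using norm_triangle_ineq[of s "of_nat j"] assms(1) by simp
  qed (use assms R in auto)
  finally show ?thesis by simp
qed

lemma summable_Suc_powr: "p > 1 \<Longrightarrow> summable (\<lambda>n. C * real (Suc n) powr (-p))"
  using summable_real_powr_iff[of "-p"] by (subst (asm) summable_Suc_iff[symmetric]) (auto intro: summable_mult)

section \<open>Continuation of a periodic Dirichlet series by repeated Abel summation\<close>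

context
  fixes N :: nat and u :: "nat \<Rightarrow> complex"
  assumes u: "mean_zero N u" and N: "N > 0"
begin

definition periodic_tail :: "nat \<Rightarrow> complex \<Rightarrow> complex" where
  "periodic_tail m s = (\<Sum>n. (centred_sums N ^^ m) u n * powr_diff m (of_nat (Suc n)) s)"

text \<open>The Dirichlet series after m summations by parts: boundary terms that are entire in s,
  plus a remainder that converges for Re s > 1 - m. For m = 0 it is the original series.\<close>

definition periodic_cont :: "nat \<Rightarrow> complex \<Rightarrow> complex" where
  "periodic_cont m s = (\<Sum>k<m. partial_mean N ((centred_sums N ^^ k) u) * powr_diff k 1 s) + periodic_tail m s"

lemma tail_bound:
  obtains C where "C > 0" "\<And>n s R \<sigma>. norm s \<le> R \<Longrightarrow> \<sigma> \<le> Re s \<Longrightarrow> 0 \<le> \<sigma> + m \<Longrightarrow>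
    norm ((centred_sums N ^^ m) u n * powr_diff m (of_nat (Suc n)) s) \<le>
      C * (R + m) ^ m * real (Suc n) powr (-(\<sigma> + m))"
proof -
  obtain C where C: "C > 0" "\<And>n. norm ((centred_sums N ^^ m) u n) \<le> C"
    using mean_zero_bounded[OF mean_zero_funpow[OF u N] N] by blast
  have "norm ((centred_sums N ^^ m) u n * powr_diff m (of_nat (Suc n)) s) \<le>
      C * (R + m) ^ m * real (Suc n) powr (-(\<sigma> + m))"
    if "norm s \<le> R" "\<sigma> \<le> Re s" "0 \<le> \<sigma> + m" for n s R \<sigma>
    unfolding norm_mult mult.assoc using C norm_powr_diff_le'[OF that] by (intro mult_mono) (auto intro: less_imp_le)
  thus ?thesis using that C(1) by blast
qed

lemma summable_tail:
  assumes "Re s > 1 - real m"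
  shows "summable (\<lambda>n. (centred_sums N ^^ m) u n * powr_diff m (of_nat (Suc n)) s)"
proof -
  obtain C where C: "\<And>n s R \<sigma>. norm s \<le> R \<Longrightarrow> \<sigma> \<le> Re s \<Longrightarrow> 0 \<le> \<sigma> + m \<Longrightarrow>
    norm ((centred_sums N ^^ m) u n * powr_diff m (of_nat (Suc n)) s) \<le>
      C * (R + m) ^ m * real (Suc n) powr (-(\<sigma> + m))"
    using tail_bound by metis
  show ?thesis
  proof (rule summable_comparison_test')
    show "summable (\<lambda>n. C * (norm s + m) ^ m * real (Suc n) powr (-(Re s + m)))"
      using assms by (intro summable_Suc_powr) auto
  qed (use C[of s "norm s" "Re s"] assms in auto)
qed

lemma holomorphic_tail: "periodic_tail m holomorphic_on {s. Re s > 1 - real m}"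
proof (rule holomorphic_uniform_sequence)
  show "open {s. Re s > 1 - real m}" by (rule open_halfspace_Re_gt)
  let ?f = "\<lambda>n s. (centred_sums N ^^ m) u n * powr_diff m (of_nat (Suc n)) s"
  show "(\<lambda>s. \<Sum>i<n. ?f i s) holomorphic_on {s. Re s > 1 - real m}" for n
    by (intro holomorphic_intros holomorphic_powr_diff) auto
  fix z :: complex assume z: "z \<in> {s. Re s > 1 - real m}"
  \<comment> \<open>Half the distance to the boundary line: on the disc of radius \<open>d\<close>
    the exponent of the majorant is still \<open>Re z - d + m = 1 + d\<close>, which exceeds
    1.\<close>
  define d where "d = (Re z - (1 - real m)) / 2"
  have d: "d > 0" using z by (simp add: d_def)
  obtain C where C: "\<And>n s R \<sigma>. norm s \<le> R \<Longrightarrow> \<sigma> \<le> Re s \<Longrightarrow> 0 \<le> \<sigma> + m \<Longrightarrow>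
    norm (?f n s) \<le> C * (R + m) ^ m * real (Suc n) powr (-(\<sigma> + m))"
    using tail_bound by metis
  have re: "Re z - d \<le> Re s" "norm s \<le> norm z + d" if "s \<in> cball z d" for s
    using that abs_Re_le_cmod[of "z - s"] norm_triangle_ineq2[of s z]
    by (auto simp: dist_norm norm_minus_commute)
  have "cball z d \<subseteq> {s. Re s > 1 - real m}"
    using re d by (force simp: d_def field_simps)
  moreover have "uniform_limit (cball z d) (\<lambda>n s. \<Sum>i<n. ?f i s) (\<lambda>s. \<Sum>i. ?f i s) sequentially"
  proof (rule Weierstrass_m_test)
    show "norm (?f n s) \<le> C * (norm z + d + m) ^ m * real (Suc n) powr (-(Re z - d + m))"
      if "s \<in> cball z d" for n s
      using re[OF that] d by (intro C) (auto simp: d_def field_simps)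
    show "summable (\<lambda>n. C * (norm z + d + m) ^ m * real (Suc n) powr (-(Re z - d + m)))"
      using d by (intro summable_Suc_powr) (auto simp: d_def field_simps)
  qed
  ultimately show "\<exists>d>0. cball z d \<subseteq> {s. Re s > 1 - real m} \<and>
      uniform_limit (cball z d) (\<lambda>n s. \<Sum>i<n. ?f i s) (periodic_tail m) sequentially"
    using d unfolding periodic_tail_def by blast
qed

lemma tail_Suc:
  assumes "Re s > 1 - real m"
  shows "periodic_tail m s = partial_mean N ((centred_sums N ^^ m) u) * powr_diff m 1 s + periodic_tail (Suc m) s"
proof -
  let ?g = "\<lambda>n. powr_diff m (of_nat (Suc n)) s"
  have "?g \<longlonglongrightarrow> 0"
  proof (rule Lim_null_comparison)
    show "\<forall>\<^sub>F n in sequentially. norm (?g n) \<le> (norm s + m) ^ m * real (Suc n) powr (-(Re s + m))"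
      using norm_powr_diff_le'[of s "norm s" "Re s" m] assms by (intro always_eventually allI) auto
    show "(\<lambda>n. (norm s + m) ^ m * real (Suc n) powr (-(Re s + m))) \<longlonglongrightarrow> 0"
      using assms by (intro summable_LIMSEQ_zero summable_Suc_powr) auto
  qed
  moreover have "(\<lambda>n. centred_sums N ((centred_sums N ^^ m) u) n * (?g n - ?g (Suc n))) sums periodic_tail (Suc m) s"
    using summable_sums[OF summable_tail[of "Suc m" s]] assms
    by (simp add: periodic_tail_def add_ac)
  ultimately have "(\<lambda>n. (centred_sums N ^^ m) u n * ?g n) sums
      (partial_mean N ((centred_sums N ^^ m) u) * ?g 0 + periodic_tail (Suc m) s)"
    by (rule sums_by_parts[OF mean_zero_funpow[OF u N] N])
  thus ?thesis unfolding periodic_tail_def[of m] by (simp add: sums_iff)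
qed

lemma periodic_cont_add:
  assumes "Re s > 1 - real m"
  shows "periodic_cont (m + k) s = periodic_cont m s"
proof (induction k)
  case (Suc k)
  have "Re s > 1 - real (m + k)" using assms by simp
  from tail_Suc[OF this] Suc show ?case by (simp add: periodic_cont_def add.assoc)
qed simp

lemma periodic_series_continuation:
  obtains f where "f holomorphic_on UNIV"
    "\<And>w. Re w > 1 \<Longrightarrow> (\<lambda>n. u n / of_nat (Suc n) powr w) sums f w"
    "f 0 = - (\<Sum>n<N. of_nat (Suc n) * u n) / of_nat N"
proof
  \<comment> \<open>The order varies with s and always satisfies \<open>Re s > 1 - m\<close>. On
    each half-plane the result agrees with \<open>periodic_cont m\<close> for one fixed m, and
    holomorphy is inherited from there.\<close>
  define f where "f = (\<lambda>s. periodic_cont (nat \<lceil>2 - Re s\<rceil>) s)"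
  have f_eq: "f s = periodic_cont m s" if "Re s > 1 - real m" for s m
  proof -
    have "Re s > 1 - real (nat \<lceil>2 - Re s\<rceil>)" by linarith
    thus ?thesis unfolding f_def using periodic_cont_add[of m s] periodic_cont_add[of "nat \<lceil>2 - Re s\<rceil>" s] that
      by (metis add.commute)
  qed
  have "f holomorphic_on (\<Union>m\<in>UNIV. {s. Re s > 1 - real m})"
  proof (rule holomorphic_on_UN_open)
    fix m :: nat
    have "periodic_cont m holomorphic_on {s. Re s > 1 - real m}"
      unfolding periodic_cont_def by (intro holomorphic_intros holomorphic_powr_diff holomorphic_tail) auto
    thus "f holomorphic_on {s. Re s > 1 - real m}"
      by (rule holomorphic_transform) (simp add: f_eq)
  qed (rule open_halfspace_Re_gt)
  moreover have "(\<Union>m\<in>UNIV. {s. Re s > 1 - real m}) = UNIV"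
  proof safe
    fix s :: complex
    have "Re s > 1 - real (nat \<lceil>2 - Re s\<rceil>)" by linarith
    thus "s \<in> (\<Union>m. {s. Re s > 1 - real m})" by blast
  qed auto
  ultimately show "f holomorphic_on UNIV" by simp
  show "(\<lambda>n. u n / of_nat (Suc n) powr w) sums f w" if "Re w > 1" for w
    using that f_eq[of 0 w] summable_sums[OF summable_tail[of 0 w]]
    by (simp add: periodic_cont_def periodic_tail_def powr_minus divide_inverse)
  \<comment> \<open>Two summations are enough, as 0 > 1 - 2. At s = 0 the powers are constant, so
    every difference of positive order vanishes and the Cesaro sum of \<open>u\<close>
    remains.\<close>
  have "f 0 = periodic_cont 2 0" by (rule f_eq) auto
  also have "\<dots> = partial_mean N u"
    by (simp add: periodic_cont_def periodic_tail_def powr_diff_at_0 eval_nat_numeral del: powr_diff.simps)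
  also have "\<dots> = - (\<Sum>n<N. of_nat (Suc n) * u n) / of_nat N"
  proof -
    have "(\<Sum>n<N. \<Sum>k\<le>n. u k) = (\<Sum>n<N. \<Sum>k<N. if k \<le> n then u k else 0)"
      by (intro sum.cong refl sum.mono_neutral_cong_left) auto
    also have "\<dots> = (\<Sum>k<N. \<Sum>n<N. if k \<le> n then u k else 0)" by (rule sum.swap)
    also have "\<dots> = (\<Sum>k<N. of_nat (N - k) * u k)"
    proof (intro sum.cong refl)
      fix k assume "k \<in> {..<N}"
      have "(\<Sum>n<N. if k \<le> n then u k else 0) = (\<Sum>n\<in>{k..<N}. u k)"
        by (intro sum.mono_neutral_cong_right) auto
      thus "(\<Sum>n<N. if k \<le> n then u k else 0) = of_nat (N - k) * u k" by simp
    qed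
    \<comment> \<open>The term \<open>u k\<close> occurs in the N - k partial sums with k \<le> n <
      N. Writing N - k as (N + 1) - (k + 1) isolates a multiple of the full-period sum, which is
      zero.\<close>
    also have "\<dots> = (\<Sum>k<N. of_nat (N + 1) * u k - of_nat (Suc k) * u k)"
      by (intro sum.cong refl) (auto simp: of_nat_diff algebra_simps)
    also have "\<dots> = of_nat (N + 1) * (\<Sum>k<N. u k) - (\<Sum>k<N. of_nat (Suc k) * u k)"
      by (simp only: sum_subtractf sum_distrib_left)
    also have "\<dots> = - (\<Sum>k<N. of_nat (Suc k) * u k)" using u by (simp add: mean_zero_def)
    finally show ?thesis by (simp add: partial_mean_def)
  qed
  finally show "f 0 = - (\<Sum>n<N. of_nat (Suc n) * u n) / of_nat N" .
qed

end

text \<open>This is the classical value -B_{1,\<psi>}. To identify it with the description in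
  \<open>dirichlet_L\<close>, any other candidate is compared with the constructed entire function
  by the identity theorem: they agree on Re w > 1, and the plane without 1 is connected.\<close>

lemma dirichlet_L_at_0:
  assumes N: "N > 0" and per: "\<And>n. \<psi> (n + int N) = \<psi> n" and "(\<Sum>n<N. \<psi> (int (Suc n))) = 0"
  shows "dirichlet_L \<psi> 0 = - (\<Sum>n<N. of_nat (Suc n) * \<psi> (int (Suc n))) / of_nat N"
proof -
  have "\<psi> (int (Suc (n + N))) = \<psi> (int (Suc n))" for n
    using per[of "int (Suc n)"] by (simp add: add_ac)
  hence u: "mean_zero N (\<lambda>n. \<psi> (int (Suc n)))" using assms by (simp add: mean_zero_def)
  obtain f where f: "f holomorphic_on UNIV"
    "\<And>w. Re w > 1 \<Longrightarrow> (\<lambda>n. \<psi> (int (Suc n)) / of_nat (Suc n) powr w) sums f w"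
    "f 0 = - (\<Sum>n<N. of_nat (Suc n) * \<psi> (int (Suc n))) / of_nat N"
    using periodic_series_continuation[OF u N] by blast
  show ?thesis unfolding dirichlet_L_def
  proof (rule the_equality)
    show "\<exists>g. g holomorphic_on - {1} \<and>
        (\<forall>w. 1 < Re w \<longrightarrow> (\<lambda>n. \<psi> (int (Suc n)) / of_nat (Suc n) powr w) sums g w) \<and>
        - (\<Sum>n<N. of_nat (Suc n) * \<psi> (int (Suc n))) / of_nat N = g 0"
      using f holomorphic_on_subset[OF f(1), of "- {1}"] by (intro exI[of _ f]) auto
  next
    fix z assume "\<exists>g. g holomorphic_on - {1} \<and>
        (\<forall>w. 1 < Re w \<longrightarrow> (\<lambda>n. \<psi> (int (Suc n)) / of_nat (Suc n) powr w) sums g w) \<and> z = g 0"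
    then obtain g where g: "g holomorphic_on - {1}"
        "\<And>w. 1 < Re w \<Longrightarrow> (\<lambda>n. \<psi> (int (Suc n)) / of_nat (Suc n) powr w) sums g w" "z = g 0"
      by blast
    have "g 0 = f 0"
    proof (rule analytic_continuation_open[where f = g and g = f and z = 0 and s = "{w. Re w > 1}" and s' = "- {1}"])
      show "connected (- {1 :: complex})" by (rule connected_punctured_universe) simp
      show "{w. Re w > 1} \<noteq> {}" by (auto intro!: exI[of _ 2])
      show "g w = f w" if "w \<in> {w. Re w > 1}" for w
        using that f(2) g(2) sums_unique2 by blast
    qed (use g(1) holomorphic_on_subset[OF f(1)] in \<open>auto intro: open_halfspace_Re_gt\<close>)
    thus "z = - (\<Sum>n<N. of_nat (Suc n) * \<psi> (int (Suc n))) / of_nat N" using f(3) g(3) by simp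
  qed
qed

subsection \<open>Orthogonality of odd characters\<close>

lemma dirichlet_character_cong:
  assumes \<psi>: "dirichlet_character N \<psi>" and "[m = n] (mod int N)"
  shows "\<psi> m = \<psi> n"
proof -
  have add: "\<psi> (x + int N * int k) = \<psi> x" for x k
  proof (induction k)
    case (Suc k)
    have "\<psi> (x + int N * int (Suc k)) = \<psi> ((x + int N * int k) + int N)"
      by (simp add: algebra_simps)
    also have "\<dots> = \<psi> (x + int N * int k)" using \<psi> unfolding dirichlet_character_def by blast
    finally show ?case using Suc by simp
  qed simp
  obtain k where k: "n = m + int N * k" using assms(2) unfolding cong_iff_lin by (auto simp: mult_ac)
  show ?thesis
    using add[of m "nat k"] add[of n "nat (-k)"] by (cases "k \<ge> 0") (auto simp: k)
qed

lemma dirichlet_character_1: "dirichlet_character N \<psi> \<Longrightarrow> \<psi> 1 = 1"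
  and dirichlet_character_mult: "dirichlet_character N \<psi> \<Longrightarrow> \<psi> (m * n) = \<psi> m * \<psi> n"
  and dirichlet_character_eq_0: "dirichlet_character N \<psi> \<Longrightarrow> \<not> coprime n (int N) \<Longrightarrow> \<psi> n = 0"
  by (auto simp: dirichlet_character_def)

lemma dirichlet_character_power:
  "dirichlet_character N \<psi> \<Longrightarrow> \<psi> (x ^ k) = \<psi> x ^ k"
  by (induction k) (auto simp: dirichlet_character_def)

text \<open>Multiplication by an h-th root of unity \<zeta> permutes the roots of -1 and scales the
  sum by \<zeta>^k. If \<zeta>^k were 1 for every such \<zeta>, then h distinct numbers would be
  roots of unity of the smaller positive order k mod h.\<close>

lemma sum_powers_roots_of_minus_one:
  assumes "h > 0" "\<not> h dvd k"
  shows "(\<Sum>\<omega> | \<omega> ^ h = -1. \<omega> ^ k) = (0 :: complex)"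
proof -
  obtain \<zeta> :: complex where \<zeta>: "\<zeta> ^ h = 1" "\<zeta> ^ k \<noteq> 1"
  proof (rule ccontr)
    assume "\<not> thesis"
    with that have *: "\<zeta> ^ k = 1" if "\<zeta> ^ h = 1" for \<zeta> :: complex using that by blast
    have pos: "k mod h > 0" using assms by (auto simp: dvd_eq_mod_eq_0)
    have "\<zeta> ^ (k mod h) = 1" if "\<zeta> ^ h = 1" for \<zeta> :: complex
    proof -
      have "\<zeta> ^ k = (\<zeta> ^ h) ^ (k div h) * \<zeta> ^ (k mod h)"
        by (simp flip: power_mult power_add)
      thus ?thesis using * that by simp
    qed
    hence "card {\<zeta> :: complex. \<zeta> ^ h = 1} \<le> card {\<zeta> :: complex. \<zeta> ^ (k mod h) = 1}"
      using pos by (intro card_mono finite_roots_unity) auto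
    hence "h \<le> k mod h" using pos assms(1) by (simp add: card_roots_unity_eq)
    thus False using mod_less_divisor[OF assms(1), of k] by linarith
  qed
  have [simp]: "\<zeta> \<noteq> 0" using \<zeta>(1) assms by (auto simp: power_0_left)
  have "(\<Sum>\<omega> | \<omega> ^ h = -1. \<omega> ^ k) = (\<Sum>\<omega> | \<omega> ^ h = -1. (\<zeta> * \<omega>) ^ k)"
    by (rule sum.reindex_bij_witness[of _ "\<lambda>\<omega>. \<zeta> * \<omega>" "\<lambda>\<omega>. \<omega> / \<zeta>"])
       (auto simp: power_mult_distrib power_divide \<zeta>(1))
  also have "\<dots> = \<zeta> ^ k * (\<Sum>\<omega> | \<omega> ^ h = -1. \<omega> ^ k)"
    by (simp add: power_mult_distrib sum_distrib_left)
  finally show ?thesis using \<zeta>(2) by (metis mult_cancel_right1)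
qed

section \<open>Odd characters modulo an odd prime, parametrised by their value at a primitive
  root\<close>

context
  fixes p g h :: nat
  assumes p: "prime p" "p > 2" and g: "residue_primroot p g" and h: "h = (p - 1) div 2"
begin

lemma p_minus_1: "p - 1 = 2 * h" "h > 0"
  using p prime_odd_nat[of p] h by (auto elim!: oddE)

lemma coprime_g: "coprime p g" and ord_g: "ord p g = p - 1"
  using g p by (auto simp: residue_primroot_def totient_prime)

lemma int_dvd_iff_not_coprime: "\<not> coprime n (int p) \<longleftrightarrow> int p dvd n"
proof
  show "int p dvd n" if "\<not> coprime n (int p)"
    using that p(1) prime_imp_coprime[of "int p" n] by (auto simp: coprime_commute)
  show "\<not> coprime n (int p)" if "int p dvd n"
    using that p(2) coprime_common_divisor[of n "int p" "int p"] by auto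
qed

lemma g_cong_iff: "[int g ^ i = int g ^ j] (mod int p) \<longleftrightarrow> [i = j] (mod (p - 1))"
  using order_divides_expdiff[OF coprime_g, of i j] cong_int_iff[of "g ^ i" "g ^ j" p]
  by (simp add: ord_g)

lemma g_power_h: "[int g ^ h = -1] (mod int p)"
proof -
  have "[int g ^ (2 * h) = int g ^ 0] (mod int p)"
    unfolding g_cong_iff p_minus_1 by (simp add: cong_def)
  moreover have "(int g ^ h - 1) * (int g ^ h + 1) = int g ^ (2 * h) - int g ^ 0"
    unfolding mult_2 power_add by (simp add: algebra_simps)
  ultimately have "int p dvd (int g ^ h - 1) * (int g ^ h + 1)"
    by (simp only: cong_iff_dvd_diff)
  hence "int p dvd int g ^ h - 1 \<or> int p dvd int g ^ h + 1"
    using p(1) by (simp add: prime_dvd_mult_iff)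
  moreover have "\<not> [int g ^ h = int g ^ 0] (mod int p)"
    unfolding g_cong_iff p_minus_1 using p_minus_1(2) by (simp add: cong_def)
  ultimately show ?thesis by (simp add: cong_iff_dvd_diff)
qed

definition dlog :: "int \<Rightarrow> nat" where
  "dlog n = inv_into {..<p - 1} (\<lambda>i. g ^ i mod p) (nat (n mod int p))"

lemma g_power_dlog:
  assumes "\<not> int p dvd n"
  shows "[int g ^ dlog n = n] (mod int p)"
proof -
  have "coprime (int p) (n mod int p)"
    using assms int_dvd_iff_not_coprime[of "n mod int p"] by (simp add: coprime_commute dvd_mod_iff)
  moreover have pos: "n mod int p > 0" using assms p by (simp add: dvd_eq_mod_eq_0 order_less_le)
  ultimately have "coprime (nat (n mod int p)) p"
    by (subst coprime_int_iff[symmetric]) (simp add: coprime_commute)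
  hence "nat (n mod int p) \<in> totatives p"
    using p pos by (auto simp: totatives_def nat_le_iff less_imp_le)
  also have "totatives p = (\<lambda>i. g ^ i mod p) ` {..<p - 1}"
    using residue_primroot_is_generator[OF _ g] p by (simp add: bij_betw_def totient_prime)
  finally have "g ^ dlog n mod p = nat (n mod int p)"
    unfolding dlog_def by (rule f_inv_into_f)
  hence "int (g ^ dlog n mod p) = n mod int p" using pos by simp
  thus ?thesis by (simp add: cong_def zmod_int)
qed

lemma power_cong_of_power_eq_minus_one:
  assumes "\<omega> ^ h = (-1 :: complex)" "[int g ^ i = int g ^ j] (mod int p)"
  shows "\<omega> ^ i = \<omega> ^ j"
proof -
  have one: "\<omega> ^ (p - 1) = 1" unfolding p_minus_1 mult.commute[of 2] power_mult assms(1) by simp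
  have red: "\<omega> ^ i = \<omega> ^ (i mod (p - 1))" for i
  proof -
    have "\<omega> ^ i = (\<omega> ^ (p - 1)) ^ (i div (p - 1)) * \<omega> ^ (i mod (p - 1))"
      by (simp del: One_nat_def flip: power_mult power_add)
    thus ?thesis by (simp only: one power_one mult_1)
  qed
  show ?thesis using assms(2) red[of i] red[of j] unfolding g_cong_iff by (simp add: cong_def)
qed

text \<open>Since g^h = -1, oddness means exactly \<omega>^h = -1. This forces \<omega>^(p-1) = 1,
  so powers of \<omega> depend only on exponents modulo p - 1, and multiplicativity does not depend
  on the choice of discrete logarithm.\<close>

lemma odd_character_exists:
  assumes "\<omega> ^ h = (-1 :: complex)"
  obtains \<psi> where "\<psi> \<in> odd_characters p" "\<psi> (int g) = \<omega>"
proof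
  define \<psi> where "\<psi> = (\<lambda>n. if int p dvd n then 0 else \<omega> ^ dlog n)"
  have nz: "\<omega> \<noteq> 0" using assms p_minus_1(2) by (auto simp: power_0_left)
  have val: "\<psi> n = \<omega> ^ i" if "[int g ^ i = n] (mod int p)" for n i
  proof -
    have "\<not> int p dvd int g ^ i"
      unfolding int_dvd_iff_not_coprime[symmetric] not_not
      using coprime_g by (intro coprime_power_left_iff[THEN iffD2]) (simp add: coprime_commute)
    hence n: "\<not> int p dvd n" using that cong_dvd_iff by blast
    have "[int g ^ dlog n = int g ^ i] (mod int p)"
      using g_power_dlog[OF n] that by (metis cong_sym cong_trans)
    thus ?thesis using power_cong_of_power_eq_minus_one[OF assms] n by (simp add: \<psi>_def)
  qed
  show g_val: "\<psi> (int g) = \<omega>" using val[of 1 "int g"] by simp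
  have "\<psi> (m * n) = \<psi> m * \<psi> n" for m n
  proof (cases "int p dvd m \<or> int p dvd n")
    case True
    thus ?thesis by (auto simp: \<psi>_def)
  next
    case False
    have "[int g ^ dlog m * int g ^ dlog n = m * n] (mod int p)"
      using False by (intro cong_mult g_power_dlog) auto
    hence "\<psi> (m * n) = \<omega> ^ (dlog m + dlog n)" by (intro val) (simp add: power_add)
    thus ?thesis using False by (simp add: \<psi>_def power_add)
  qed
  moreover have "\<psi> (n + int p) = \<psi> n" for n
    by (simp add: \<psi>_def dlog_def)
  moreover have "\<psi> 1 = 1" using val[of 0 1] by simp
  moreover have "\<psi> n = 0 \<longleftrightarrow> \<not> coprime n (int p)" for n
    unfolding int_dvd_iff_not_coprime by (simp add: \<psi>_def nz)
  moreover have "\<psi> (-1) = -1" using val[OF g_power_h] assms by simp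
  ultimately show "\<psi> \<in> odd_characters p"
    by (simp add: odd_characters_def dirichlet_character_def)
qed

lemma odd_character_power_h:
  assumes "\<psi> \<in> odd_characters p"
  shows "\<psi> (int g) ^ h = -1"
proof -
  have c: "dirichlet_character p \<psi>" using assms by (simp add: odd_characters_def)
  have "\<psi> (int g) ^ h = \<psi> (int g ^ h)" by (simp add: dirichlet_character_power[OF c])
  also have "\<dots> = \<psi> (-1)" by (rule dirichlet_character_cong[OF c g_power_h])
  finally show ?thesis using assms by (simp add: odd_characters_def)
qed

lemma odd_character_eq:
  assumes "\<psi> \<in> odd_characters p" "\<not> int p dvd n"
  shows "\<psi> n = \<psi> (int g) ^ dlog n"
proof -
  have c: "dirichlet_character p \<psi>" using assms by (simp add: odd_characters_def)
  show ?thesis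
    using dirichlet_character_cong[OF c g_power_dlog[OF assms(2)]]
    by (simp add: dirichlet_character_power[OF c])
qed

lemma bij_betw_odd_characters:
  "bij_betw (\<lambda>\<psi>. \<psi> (int g)) (odd_characters p) {\<omega>. \<omega> ^ h = -1}"
  unfolding bij_betw_def
proof
  show "inj_on (\<lambda>\<psi>. \<psi> (int g)) (odd_characters p)"
  proof (rule inj_onI, rule ext)
    fix \<psi> \<phi> n assume *: "\<psi> \<in> odd_characters p" "\<phi> \<in> odd_characters p" "\<psi> (int g) = \<phi> (int g)"
    show "\<psi> n = \<phi> n"
    proof (cases "int p dvd n")
      case True
      hence "\<not> coprime n (int p)" using int_dvd_iff_not_coprime by blast
      hence "\<psi> n = 0" "\<phi> n = 0"
        using * dirichlet_character_eq_0[of p _ n] by (auto simp: odd_characters_def)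
      thus ?thesis by simp
    next
      case False
      show ?thesis using odd_character_eq[OF *(1) False] odd_character_eq[OF *(2) False] *(3) by simp
    qed
  qed
  show "(\<lambda>\<psi>. \<psi> (int g)) ` odd_characters p = {\<omega>. \<omega> ^ h = -1}"
    proof safe
    fix \<omega> :: complex assume "\<omega> ^ h = -1"
    then obtain \<psi> where "\<psi> \<in> odd_characters p" "\<psi> (int g) = \<omega>"
      by (rule odd_character_exists)
    thus "\<omega> \<in> (\<lambda>\<psi>. \<psi> (int g)) ` odd_characters p" by blast
  qed (rule odd_character_power_h)
qed

text \<open>For a prime to p, evaluation at g turns the sum into one of k-th powers of the h-th
  roots of -1, with k the discrete logarithm of a. It vanishes unless h divides k, that is, unless a
  is 1 or -1 modulo p.\<close>

lemma sum_odd_characters_primroot: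
  "(\<Sum>\<psi>\<in>odd_characters p. \<psi> a) =
     (if [a = 1] (mod int p) then of_nat h else if [a = -1] (mod int p) then - of_nat h else 0)"
proof -
  have c: "dirichlet_character p \<psi>" if "\<psi> \<in> odd_characters p" for \<psi>
    using that by (simp add: odd_characters_def)
  have card: "card (odd_characters p) = h"
    using bij_betw_same_card[OF bij_betw_odd_characters] card_nth_roots[of "-1" h] p_minus_1(2) by simp
  consider "[a = 1] (mod int p)" | "\<not> [a = 1] (mod int p)" "[a = -1] (mod int p)"
    | "\<not> [a = 1] (mod int p)" "\<not> [a = -1] (mod int p)" "int p dvd a"
    | "\<not> [a = 1] (mod int p)" "\<not> [a = -1] (mod int p)" "\<not> int p dvd a" by blast
  thus ?thesis
  proof cases
    case 1
    have "(\<Sum>\<psi>\<in>odd_characters p. \<psi> a) = (\<Sum>\<psi>\<in>odd_characters p. 1)"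
    proof (rule sum.cong[OF refl])
      fix \<psi> assume "\<psi> \<in> odd_characters p"
      thus "\<psi> a = 1" using dirichlet_character_cong[OF c 1] dirichlet_character_1[OF c] by metis
    qed
    thus ?thesis using 1 card by simp
  next
    case 2
    have "(\<Sum>\<psi>\<in>odd_characters p. \<psi> a) = (\<Sum>\<psi>\<in>odd_characters p. -1)"
    proof (rule sum.cong[OF refl])
      fix \<psi> assume *: "\<psi> \<in> odd_characters p"
      have "\<psi> a = \<psi> (-1)" by (rule dirichlet_character_cong[OF c[OF *] 2(2)])
      thus "\<psi> a = -1" using * by (simp add: odd_characters_def)
    qed
    thus ?thesis using 2 card by simp
  next
    case 3
    have "(\<Sum>\<psi>\<in>odd_characters p. \<psi> a) = 0"
    proof (rule sum.neutral, rule ballI)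
      fix \<psi> assume "\<psi> \<in> odd_characters p"
      thus "\<psi> a = 0" using dirichlet_character_eq_0[OF c] int_dvd_iff_not_coprime[of a] 3(3) by metis
    qed
    thus ?thesis using 3 by simp
  next
    case 4
    \<comment> \<open>If the exponent were h j, then a would be congruent to (g^h)^j = (-1)^j, which
      the present case excludes.\<close>
    have "\<not> h dvd dlog a"
    proof
      assume "h dvd dlog a"
      then obtain j where j: "dlog a = h * j" by (auto elim: dvdE)
      have "[int g ^ dlog a = (-1) ^ j] (mod int p)"
        unfolding j power_mult by (intro cong_pow g_power_h)
      hence "[a = (-1) ^ j] (mod int p)"
        using g_power_dlog[OF 4(3)] cong_sym cong_trans by blast
      thus False using 4 by (cases "even j") auto
    qed
    have "(\<Sum>\<psi>\<in>odd_characters p. \<psi> a) = (\<Sum>\<psi>\<in>odd_characters p. \<psi> (int g) ^ dlog a)"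
      by (rule sum.cong[OF refl]) (rule odd_character_eq[OF _ 4(3)])
    also have "\<dots> = (\<Sum>\<omega> | \<omega> ^ h = -1. \<omega> ^ dlog a)"
      by (rule sum.reindex_bij_betw[OF bij_betw_odd_characters])
    also have "\<dots> = 0"
      using \<open>\<not> h dvd dlog a\<close> p_minus_1(2) by (intro sum_powers_roots_of_minus_one)
    finally show ?thesis using 4 by simp
  qed
qed

end

theorem sum_odd_characters:
  assumes "prime p" "p > 2"
  shows "(\<Sum>\<psi>\<in>odd_characters p. \<psi> a) =
     (if [a = 1] (mod int p) then (of_nat p - 1) / 2
      else if [a = -1] (mod int p) then - (of_nat p - 1) / 2 else 0)"
proof -
  obtain g where g: "residue_primroot p g"
    using prime_primitive_root_exists[OF _ assms(1)] assms(2) by auto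
  have "odd p" using assms prime_odd_nat by blast
  hence "of_nat ((p - 1) div 2) = (of_nat p - 1) / (2 :: complex)"
    by (auto elim!: oddE)
  thus ?thesis using sum_odd_characters_primroot[OF assms g refl, of a] by simp
qed

subsection \<open>Lambert series with periodic coefficients\<close>

definition lambert :: "complex \<Rightarrow> complex \<Rightarrow> complex" where
  "lambert Q x = (\<Sum>n. x ^ Suc n / (1 - Q ^ Suc n))"

lemma has_sum_lambert:
  assumes "norm Q < 1" "norm x < 1"
  shows "((\<lambda>n. x ^ Suc n / (1 - Q ^ Suc n)) has_sum lambert Q x) UNIV"
proof -
  have le: "norm (x ^ Suc n / (1 - Q ^ Suc n)) \<le> 1 / (1 - norm Q) * norm x ^ Suc n" for n
  proof -
    have "norm Q ^ Suc n \<le> norm Q ^ 1" using assms by (intro power_decreasing) auto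
    moreover have "norm (1 - Q ^ Suc n) \<ge> 1 - norm Q ^ Suc n"
      by (metis norm_one norm_power norm_triangle_ineq2)
    ultimately have "norm (1 - Q ^ Suc n) \<ge> 1 - norm Q" by simp
    hence "norm x ^ Suc n / norm (1 - Q ^ Suc n) \<le> norm x ^ Suc n / (1 - norm Q)"
      using assms by (intro divide_left_mono mult_pos_pos) auto
    thus ?thesis by (simp only: norm_divide norm_power) simp
  qed
  have "summable (\<lambda>n. 1 / (1 - norm Q) * norm x ^ Suc n)"
    using assms by (intro summable_mult, subst summable_Suc_iff) (auto intro: summable_geometric)
  hence "summable (\<lambda>n. norm (x ^ Suc n / (1 - Q ^ Suc n)))"
    by (rule summable_comparison_test') (use le in auto)
  from norm_summable_imp_has_sum[OF this summable_sums[OF summable_norm_cancel[OF this]]]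
  show ?thesis by (simp only: lambert_def)
qed

text \<open>By \<open>lambert_coeff_minus_mult\<close> the index -n contributes -(Q/x)^n / (1 -
  Q^n). This connects the one-sided series in the definition of the Eisenstein series with the
  bilateral ones, which satisfy the quadratic relation.\<close>

lemma lambert_bilateral_eq_lambert:
  assumes "Q \<noteq> 0" "norm Q < norm x" "norm x < 1"
  shows "lambert_bilateral Q x = lambert Q x - lambert Q (Q / x)"
proof -
  have nz: "x \<noteq> 0" and Q: "norm Q < 1" and y: "norm (Q / x) < 1"
    using assms by (auto simp: norm_divide divide_less_eq)
  have "((\<lambda>n. x ^ Suc n / (1 - Q ^ Suc n)) has_sum lambert Q x) UNIV"
    by (rule has_sum_lambert[OF Q assms(3)])
  also have "?this \<longleftrightarrow> ((\<lambda>n. lambert_coeff Q n * x powi n) has_sum lambert Q x) {0<..}"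
    by (rule has_sum_reindex_bij_witness[where i = "\<lambda>n. nat n - 1" and j = "\<lambda>n. int (Suc n)"])
       (auto simp: lambert_coeff_def power_int_def nat_add_distrib)
  finally have pos: "((\<lambda>n. lambert_coeff Q n * x powi n) has_sum lambert Q x) {0<..}" .
  have "((\<lambda>n. - ((Q / x) ^ Suc n / (1 - Q ^ Suc n))) has_sum - lambert Q (Q / x)) UNIV"
    by (rule has_sum_uminusI[OF has_sum_lambert[OF Q y]])
  also have "?this \<longleftrightarrow> ((\<lambda>n. lambert_coeff Q n * x powi n) has_sum - lambert Q (Q / x)) {..<0}"
  proof (rule has_sum_reindex_bij_witness[where i = "\<lambda>n. nat (-n) - 1" and j = "\<lambda>n. - int (Suc n)"])
    fix n :: nat
    have "lambert_coeff Q (- int (Suc n)) * x powi (- int (Suc n)) = - (Q ^ Suc n * lambert_coeff Q (int (Suc n))) * inverse (x ^ Suc n)"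
      using lambert_coeff_minus_mult[OF assms(1) Q, of "int (Suc n)"]
      by (simp only: power_int_minus power_int_of_nat)
    also have "lambert_coeff Q (int (Suc n)) = 1 / (1 - Q ^ Suc n)"
      unfolding lambert_coeff_def by (simp only: power_int_of_nat) simp
    finally show "lambert_coeff Q (- int (Suc n)) * x powi (- int (Suc n)) = - ((Q / x) ^ Suc n / (1 - Q ^ Suc n))"
      by (simp add: power_mult_distrib power_inverse divide_inverse mult_ac)
  qed auto
  finally have neg: "((\<lambda>n. lambert_coeff Q n * x powi n) has_sum - lambert Q (Q / x)) {..<0}" .
  have "((\<lambda>n. lambert_coeff Q n * x powi n) has_sum lambert Q x + - lambert Q (Q / x)) ({0<..} \<union> {..<0})"
    by (rule has_sum_Un_disjoint[OF pos neg]) auto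
  also have "?this \<longleftrightarrow> ((\<lambda>n. lambert_coeff Q n * x powi n) has_sum lambert Q x + - lambert Q (Q / x)) UNIV"
  proof (rule has_sum_cong_neutral)
    fix n :: int assume "n \<in> UNIV - ({0<..} \<union> {..<0})"
    hence "n = 0" by auto
    thus "lambert_coeff Q n * x powi n = 0" by (simp add: lambert_coeff_def)
  qed auto
  finally show ?thesis using has_sum_unique[OF has_sum_lambert_bilateral(1)[OF assms]] by simp
qed

lemma sums_periodic_power:
  fixes z :: complex and u :: "nat \<Rightarrow> complex"
  assumes "norm z < 1" "N > 0" "\<And>n. u (n + N) = u n" "\<And>n. norm (u n) \<le> B"
  shows "(\<lambda>n. u n * z ^ Suc n) sums ((\<Sum>c<N. u c * z ^ Suc c) / (1 - z ^ N))"
proof -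
  have "summable (\<lambda>n. B * norm z ^ Suc n)"
    using assms by (intro summable_mult, subst summable_Suc_iff) (auto intro: summable_geometric)
  hence summ: "summable (\<lambda>n. u n * z ^ Suc n)"
    by (rule summable_comparison_test') (use assms(4) in \<open>auto simp: norm_mult norm_power intro!: mult_right_mono\<close>)
  define s where "s = (\<Sum>n. u n * z ^ Suc n)"
  have "s = (\<Sum>n. u (n + N) * z ^ Suc (n + N)) + (\<Sum>c<N. u c * z ^ Suc c)"
    unfolding s_def by (rule suminf_split_initial_segment[OF summ])
  also have "(\<lambda>n. u (n + N) * z ^ Suc (n + N)) = (\<lambda>n. z ^ N * (u n * z ^ Suc n))"
    by (simp add: assms(3) power_add mult_ac)
  also have "(\<Sum>n. z ^ N * (u n * z ^ Suc n)) = z ^ N * s"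
    unfolding s_def by (rule suminf_mult[OF summ])
  finally have "s * (1 - z ^ N) = (\<Sum>c<N. u c * z ^ Suc c)" by (simp add: algebra_simps)
  moreover have "z ^ N \<noteq> 1"
  proof
    assume "z ^ N = 1"
    hence "norm z ^ N = 1" by (metis norm_one norm_power)
    moreover have "norm z ^ N < 1" using assms by (intro power_less_one_iff[THEN iffD2]) auto
    ultimately show False by simp
  qed
  ultimately have "s = (\<Sum>c<N. u c * z ^ Suc c) / (1 - z ^ N)" by (simp add: field_simps)
  thus ?thesis using summable_sums[OF summ] by (simp add: s_def)
qed

lemma has_sum_finite_sum:
  fixes f :: "'b \<Rightarrow> 'a \<Rightarrow> complex"
  assumes "finite I" "\<And>i. i \<in> I \<Longrightarrow> (f i has_sum S i) A"
  shows "((\<lambda>x. \<Sum>i\<in>I. f i x) has_sum (\<Sum>i\<in>I. S i)) A"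
  using assms by (induction I rule: finite_induct) (auto intro: has_sum_add)

text \<open>Expanding q^k / (1 - q^k) geometrically gives an absolutely convergent double series in
  q^(k n). When it is summed over k first, periodicity collapses the inner sum to N terms over the
  common denominator 1 - q^(N n), and these are terms of Lambert series in q^N.\<close>

lemma periodic_lambert:
  fixes q :: complex and u :: "nat \<Rightarrow> complex"
  assumes q: "norm q < 1" and N: "N > 0" and per: "\<And>n. u (n + N) = u n" and B: "\<And>n. norm (u n) \<le> B"
  shows "(\<Sum>n. u n * (q ^ Suc n / (1 - q ^ Suc n))) = (\<Sum>c<N. u c * lambert (q ^ N) (q ^ Suc c))"
proof -
  define a where "a = (\<lambda>(k, n). u k * q ^ (Suc k * Suc n))"
  have g: "(\<lambda>n. norm (norm q ^ n)) summable_on (UNIV :: nat set)"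
    using q by (subst summable_on_UNIV_nonneg_real_iff) (auto simp: summable_geometric)
  have g': "(\<lambda>n. norm (complex_of_real (norm q ^ n))) summable_on (UNIV :: nat set)"
    using g by (simp add: norm_power)
  have B0: "B \<ge> 0" using B[of 0] norm_ge_zero order_trans by blast
  have "(\<lambda>p. B * norm (case p of (k, n) \<Rightarrow> complex_of_real (norm q ^ k) * complex_of_real (norm q ^ n))) summable_on (UNIV \<times> UNIV)"
    by (rule summable_on_cmult_right[OF abs_summable_on_Times_mult[OF g' g']])
  hence "(\<lambda>p. norm (a p)) summable_on (UNIV \<times> UNIV)"
  proof (rule Infinite_Sum.abs_summable_on_comparison_test')
    fix p :: "nat \<times> nat"
    obtain k n where p: "p = (k, n)" by (cases p)
    have "norm (a p) = norm (u k) * norm q ^ (Suc k * Suc n)" by (simp add: a_def p norm_mult norm_power power_add)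
    \<comment> \<open>As (k + 1)(n + 1) \<ge> k + n, a product of two geometric series is a
      majorant.\<close>
    also have "\<dots> \<le> B * norm q ^ (k + n)"
      using q B B0 by (intro mult_mono power_decreasing) auto
    finally show "norm (a p) \<le> B * norm (case p of (k, n) \<Rightarrow> complex_of_real (norm q ^ k) * complex_of_real (norm q ^ n))"
      by (simp add: p norm_mult norm_power power_add)
  qed
  hence "a summable_on (UNIV \<times> UNIV)" by (rule abs_summable_summable)
  then obtain T where T: "(a has_sum T) (UNIV \<times> UNIV)" by (auto simp: summable_on_def)
  have qS: "norm (q ^ Suc m) < 1" for m
    unfolding norm_power using q by (intro power_less_one_iff[THEN iffD2]) auto
  have geo: "((\<lambda>n. a (k, n)) has_sum u k * (q ^ Suc k / (1 - q ^ Suc k))) UNIV" for k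
  proof -
    have "((\<lambda>n. (q ^ Suc k) ^ n) has_sum (q ^ Suc k / (1 - q ^ Suc k))) {1..}"
      by (rule has_sum_geometric_from_1[OF qS])
    also have "?this \<longleftrightarrow> ((\<lambda>n. (q ^ Suc k) ^ Suc n) has_sum (q ^ Suc k / (1 - q ^ Suc k))) UNIV"
      by (rule has_sum_reindex_bij_witness[of _ Suc "\<lambda>n. n - 1"]) auto
    finally have "((\<lambda>n. u k * (q ^ Suc k) ^ Suc n) has_sum u k * (q ^ Suc k / (1 - q ^ Suc k))) UNIV"
      by (rule has_sum_cmult_right)
    thus ?thesis by (simp only: a_def prod.case power_mult)
  qed
  have 1: "((\<lambda>k. u k * (q ^ Suc k / (1 - q ^ Suc k))) has_sum T) UNIV"
    by (rule has_sum_SigmaD[OF T geo])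
  define b where "b = (\<lambda>(n, k). a (k, n))"
  have b: "(b has_sum T) (UNIV \<times> UNIV)"
    using T unfolding b_def by (subst (asm) has_sum_swap)
  have bs: "((\<lambda>k. b (n, k)) has_sum (\<Sum>c<N. u c * ((q ^ Suc c) ^ Suc n / (1 - (q ^ N) ^ Suc n)))) UNIV" for n
  proof -
    let ?z = "q ^ Suc n"
    have "summable (\<lambda>k. B * norm ?z ^ Suc k)"
      using qS by (intro summable_mult, subst summable_Suc_iff) (auto intro!: summable_geometric simp del: power_Suc)
    hence "summable (\<lambda>k. norm (u k * ?z ^ Suc k))"
      by (rule summable_comparison_test')
         (use B in \<open>auto simp: norm_mult norm_power intro!: mult_right_mono simp del: power_Suc\<close>)
    hence "((\<lambda>k. u k * ?z ^ Suc k) has_sum ((\<Sum>c<N. u c * ?z ^ Suc c) / (1 - ?z ^ N))) UNIV"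
      by (rule norm_summable_imp_has_sum) (rule sums_periodic_power[where u = u and B = B, OF qS N per B])
    moreover have "u k * ?z ^ Suc k = b (n, k)" for k
      unfolding a_def b_def prod.case by (simp only: mult.commute[of "Suc k"] power_mult)
    moreover have "u c * ?z ^ Suc c / (1 - ?z ^ N) = u c * ((q ^ Suc c) ^ Suc n / (1 - (q ^ N) ^ Suc n))" for c
      by (simp only: power_mult[symmetric] mult.commute times_divide_eq_right)
    ultimately show ?thesis by (simp only: sum_divide_distrib)
  qed
  have 2: "((\<lambda>n. \<Sum>c<N. u c * ((q ^ Suc c) ^ Suc n / (1 - (q ^ N) ^ Suc n))) has_sum T) UNIV"
    by (rule has_sum_SigmaD[OF b bs])
  have qN: "norm (q ^ N) < 1" using qS[of "N - 1"] N by simp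
  have "((\<lambda>n. \<Sum>c<N. u c * ((q ^ Suc c) ^ Suc n / (1 - (q ^ N) ^ Suc n))) has_sum
      (\<Sum>c<N. u c * lambert (q ^ N) (q ^ Suc c))) UNIV"
    by (intro has_sum_finite_sum has_sum_cmult_right has_sum_lambert qS qN) auto
  with 2 have "T = (\<Sum>c<N. u c * lambert (q ^ N) (q ^ Suc c))" using has_sum_unique by blast
  thus ?thesis using has_sum_imp_sums[OF 1] by (simp add: sums_iff)
qed

subsection \<open>Level 19\<close>

text \<open>Modulo 19 the powers 2^0, ..., 2^8 and their negatives exhaust the nonzero residues, and
  2^9 = -1. Every value is therefore a signed power of \<omega>, of exponent at most 8.\<close>

lemma odd_character_19_values:
  assumes "\<psi> \<in> odd_characters 19"
  defines "\<omega> \<equiv> \<psi> 2"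
  shows "\<omega> ^ 9 = -1"
    "\<psi> 1 = 1" "\<psi> 2 = \<omega>" "\<psi> 3 = - (\<omega> ^ 4)" "\<psi> 4 = \<omega> ^ 2" "\<psi> 5 = - (\<omega> ^ 7)" "\<psi> 6 = - (\<omega> ^ 5)"
    "\<psi> 7 = \<omega> ^ 6" "\<psi> 8 = \<omega> ^ 3" "\<psi> 9 = \<omega> ^ 8" "\<psi> 10 = - (\<omega> ^ 8)" "\<psi> 11 = - (\<omega> ^ 3)"
    "\<psi> 12 = - (\<omega> ^ 6)" "\<psi> 13 = \<omega> ^ 5" "\<psi> 14 = \<omega> ^ 7" "\<psi> 15 = - (\<omega> ^ 2)" "\<psi> 16 = \<omega> ^ 4"
    "\<psi> 17 = - \<omega>" "\<psi> 18 = -1" "\<psi> 19 = 0"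
proof -
  have c: "dirichlet_character 19 \<psi>" and m1: "\<psi> (-1) = -1"
    using assms by (auto simp: odd_characters_def)
  have pos: "\<psi> n = \<omega> ^ k" if "[n = 2 ^ k] (mod 19)" for n k
    using dirichlet_character_cong[OF c, of n "2 ^ k"] that
    by (simp add: \<omega>_def dirichlet_character_power[OF c])
  have neg: "\<psi> n = - (\<omega> ^ k)" if "[n = (-1) * 2 ^ k] (mod 19)" for n k
    using dirichlet_character_cong[OF c, of n "(-1) * 2 ^ k"] that
    by (simp only: dirichlet_character_mult[OF c] dirichlet_character_power[OF c] m1 \<omega>_def) simp
  show "\<omega> ^ 9 = -1" using pos[of "-1" 9] m1 by (simp add: cong_def)
  show "\<psi> 1 = 1" using dirichlet_character_1[OF c] .
  show "\<psi> 2 = \<omega>" by (simp add: \<omega>_def)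
  show "\<psi> 19 = 0" by (rule dirichlet_character_eq_0[OF c]) simp
  show "\<psi> 4 = \<omega> ^ 2" "\<psi> 8 = \<omega> ^ 3" "\<psi> 16 = \<omega> ^ 4" "\<psi> 13 = \<omega> ^ 5" "\<psi> 7 = \<omega> ^ 6" "\<psi> 14 = \<omega> ^ 7" "\<psi> 9 = \<omega> ^ 8"
    by (rule pos; simp add: cong_def)+
  show "\<psi> 15 = - (\<omega> ^ 2)" "\<psi> 11 = - (\<omega> ^ 3)" "\<psi> 3 = - (\<omega> ^ 4)" "\<psi> 6 = - (\<omega> ^ 5)" "\<psi> 12 = - (\<omega> ^ 6)" "\<psi> 5 = - (\<omega> ^ 7)" "\<psi> 10 = - (\<omega> ^ 8)"
    by (rule neg; simp add: cong_def)+
  show "\<psi> 17 = - \<omega>" using neg[of 17 1] by (simp add: cong_def)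
  show "\<psi> 18 = -1" using neg[of 18 0] by (simp add: cong_def)
qed

lemma sum_lessThan_19: "(\<Sum>n<19. f n) = f 0 + f 1 + f 2 + f 3 + f 4 + f 5 + f 6 + f 7 + f 8 + f 9 + f 10 + f 11 + f 12 + f 13 + f 14 + f 15 + f 16 + f 17 + f 18"
  for f :: "nat \<Rightarrow> complex"
  by (simp add: eval_nat_numeral)

lemma dirichlet_L_19:
  assumes "\<psi> \<in> odd_characters 19"
  shows "2 / dirichlet_L \<psi> 0 = \<psi> 4 + \<psi> 5 + \<psi> 11 + \<psi> 13"
proof -
  note v = odd_character_19_values[OF assms]
  define \<omega> where "\<omega> = \<psi> 2"
  note v = v(1,2,4-20)[folded \<omega>_def]
  have per: "\<psi> (n + int 19) = \<psi> n" for n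
    using assms unfolding odd_characters_def dirichlet_character_def by blast
  have "dirichlet_L \<psi> 0 = - (\<Sum>n<19. of_nat (Suc n) * \<psi> (int (Suc n))) / of_nat 19"
  proof (rule dirichlet_L_at_0[where \<psi> = \<psi> and N = 19, OF _ per])
    show "(\<Sum>n<19. \<psi> (int (Suc n))) = 0" by (simp add: sum_lessThan_19 v \<omega>_def[symmetric])
  qed simp
  \<comment> \<open>Pairing n with 19 - n gives \<omega>^k the coefficient 19 - 2r, where r is the
    residue of 2^k modulo 19.\<close>
  also have "\<dots> = (17 + 15 * \<omega> + 11 * \<omega> ^ 2 + 3 * \<omega> ^ 3 - 13 * \<omega> ^ 4 - 7 * \<omega> ^ 5 + 5 * \<omega> ^ 6
      - 9 * \<omega> ^ 7 + \<omega> ^ 8) / 19"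
    by (simp add: sum_lessThan_19 v \<omega>_def[symmetric])
  finally have L: "19 * dirichlet_L \<psi> 0 = 17 + 15 * \<omega> + 11 * \<omega> ^ 2 + 3 * \<omega> ^ 3 - 13 * \<omega> ^ 4 - 7 * \<omega> ^ 5 + 5 * \<omega> ^ 6
      - 9 * \<omega> ^ 7 + \<omega> ^ 8" by (simp add: mult.commute)
  \<comment> \<open>The first factor is \<psi>(4) + \<psi>(5) + \<psi>(11) + \<psi>(13) written in
    \<omega>. The right-hand side displays the division of the product by \<omega>^9 + 1: remainder
    38, and the long factor as quotient.\<close>
  have "(\<omega> ^ 2 - \<omega> ^ 7 - \<omega> ^ 3 + \<omega> ^ 5) * (19 * dirichlet_L \<psi> 0) = 38 + (\<omega> ^ 9 + 1) * (-38 + 17 * \<omega> ^ 2 - 2 * \<omega> ^ 3 - 4 * \<omega> ^ 4 + 9 * \<omega> ^ 5 - \<omega> ^ 6)"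
    unfolding L by (simp add: field_simps eval_nat_numeral)
  also have "\<dots> = 38" unfolding v(1) by simp
  finally have "19 * ((\<psi> 4 + \<psi> 5 + \<psi> 11 + \<psi> 13) * dirichlet_L \<psi> 0) = 38"
    by (simp add: v algebra_simps)
  hence "(\<psi> 4 + \<psi> 5 + \<psi> 11 + \<psi> 13) * dirichlet_L \<psi> 0 = 2" by (simp add: mult.commute)
  \<comment> \<open>The product being 2 already excludes a zero, so no separate nonvanishing
    argument is called for before dividing.\<close>
  moreover from this have "dirichlet_L \<psi> 0 \<noteq> 0" by auto
  ultimately show ?thesis by (simp add: field_simps)
qed

text \<open>As 2/L(0,\<psi>) is a sum of values of \<psi>, the product \<psi>(a) E_{1,\<psi>} is
  linear in values \<psi>(a j c), and orthogonality applies to each of them. \<open>D\<close> is the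
  resulting character sum divided by 9, which cancels the prefactor 2/18.\<close>

lemma eisenstein_E_19:
  assumes "Im \<tau> > 0"
  defines "q \<equiv> exp (2 * of_real pi * \<i> * \<tau>)"
  defines "D \<equiv> \<lambda>n. if [n = 1] (mod 19) then 1 else if [n = -1] (mod 19) then -1 else (0::complex)"
  shows "eisenstein_E 19 a \<tau> = D a + (\<Sum>j\<in>{4,5,11,13}. \<Sum>c<19. D (a * j * int (Suc c)) * lambert (q ^ 19) (q ^ Suc c))"
proof -
  have q: "norm q < 1"
    using assms(1) by (simp add: q_def)
  have orth: "(\<Sum>\<psi>\<in>odd_characters 19. \<psi> n) = 9 * D n" for n
    using sum_odd_characters[of 19 n] by (simp add: D_def)
  have mult: "\<psi> (m * n) = \<psi> m * \<psi> n" if "\<psi> \<in> odd_characters 19" for \<psi> m n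
    using that dirichlet_character_mult[of 19 \<psi> m n] by (simp add: odd_characters_def)
  have E1: "eisenstein_E1 \<psi> \<tau> = 1 + (\<Sum>j\<in>{4,5,11,13}. \<psi> j) * (\<Sum>c<19. \<psi> (int (Suc c)) * lambert (q ^ 19) (q ^ Suc c))"
    if \<psi>: "\<psi> \<in> odd_characters 19" for \<psi>
  proof -
    have per: "\<psi> (int (Suc (n + 19))) = \<psi> (int (Suc n))" for n
    proof (rule dirichlet_character_cong[where N = 19])
      show "[int (Suc (n + 19)) = int (Suc n)] (mod int 19)" by (simp add: cong_iff_dvd_diff)
    qed (use \<psi> in \<open>simp add: odd_characters_def\<close>)
    define B where "B = (\<Sum>n<19. norm (\<psi> (int (Suc n))))"
    have B: "norm (\<psi> (int (Suc n))) \<le> B" for n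
    proof (induction n rule: less_induct)
      case (less n)
      show ?case
      proof (cases "n < 19")
        case True
        thus ?thesis unfolding B_def by (intro member_le_sum) auto
      next
        case False
        hence "\<psi> (int (Suc n)) = \<psi> (int (Suc (n - 19)))" using per[of "n - 19"] by simp
        thus ?thesis using less.IH[of "n - 19"] False by simp
      qed
    qed
    have "(\<Sum>n. \<psi> (int (Suc n)) * (q ^ Suc n / (1 - q ^ Suc n))) =
        (\<Sum>c<19. \<psi> (int (Suc c)) * lambert (q ^ 19) (q ^ Suc c))"
      by (rule periodic_lambert[where B = B and N = 19 and u = "\<lambda>n. \<psi> (int (Suc n))", OF q _ per B]) simp
    thus ?thesis
      unfolding eisenstein_E1_def Let_def q_def[symmetric] dirichlet_L_19[OF \<psi>]
      by (simp add: add_ac)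
  qed
  have "(\<Sum>\<psi>\<in>odd_characters 19. \<psi> a * eisenstein_E1 \<psi> \<tau>) =
      (\<Sum>\<psi>\<in>odd_characters 19. \<psi> a + (\<Sum>j\<in>{4,5,11,13}. \<Sum>c<19. \<psi> (a * j * int (Suc c)) * lambert (q ^ 19) (q ^ Suc c)))"
  proof (rule sum.cong[OF refl])
    fix \<psi> assume \<psi>: "\<psi> \<in> odd_characters 19"
    show "\<psi> a * eisenstein_E1 \<psi> \<tau> = \<psi> a + (\<Sum>j\<in>{4,5,11,13}. \<Sum>c<19. \<psi> (a * j * int (Suc c)) * lambert (q ^ 19) (q ^ Suc c))"
      unfolding E1[OF \<psi>] sum_product mult[OF \<psi>] ring_distribs
      by (simp only: sum_distrib_left mult_1_right mult.assoc)
  qed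
  also have "\<dots> = (\<Sum>\<psi>\<in>odd_characters 19. \<psi> a) +
      (\<Sum>j\<in>{4,5,11,13}. \<Sum>c<19. (\<Sum>\<psi>\<in>odd_characters 19. \<psi> (a * j * int (Suc c))) * lambert (q ^ 19) (q ^ Suc c))"
    unfolding sum.distrib sum_distrib_right
    by (subst sum.swap, subst sum.swap[of _ _ "{..<19}"]) (rule refl)
  also have "\<dots> = 9 * (D a + (\<Sum>j\<in>{4,5,11,13}. \<Sum>c<19. D (a * j * int (Suc c)) * lambert (q ^ 19) (q ^ Suc c)))"
    unfolding orth by (simp only: sum_distrib_left ring_distribs mult.assoc)
  finally show ?thesis unfolding eisenstein_E_def by simp
qed

text \<open>This separates analysis from algebra: only the quadratic relations, the two symmetries
  and the nine linear expressions are passed on, and the ten identities follow from them by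
  polynomial arithmetic.\<close>

lemma eisenstein_E_19_relations:
  fixes \<tau> :: complex and E :: "int \<Rightarrow> complex"
  assumes \<tau>: "Im \<tau> > 0" and E: "\<And>a. E a = eisenstein_E 19 a \<tau>"
  obtains t W :: "nat \<Rightarrow> complex" where
    "\<And>a b c. 0 < a \<Longrightarrow> 0 < b \<Longrightarrow> 0 < c \<Longrightarrow> a + b + c = 19 \<Longrightarrow> t a * t b + t a * t c + t b * t c = W a + W b + W c"
    "\<And>a. 0 < a \<Longrightarrow> a < 19 \<Longrightarrow> t (19 - a) = - t a"
    "\<And>a. 0 < a \<Longrightarrow> a < 19 \<Longrightarrow> W (19 - a) = W a"
    "E 1 = t 3 + t 4 + t 5 + t 7"
    "E 2 = t 2 - t 6 - t 7 - t 8"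
    "E 3 = t 1 - t 4 - t 5 + t 8"
    "E 4 = t 1 - t 3 - t 4 + t 6"
    "E 5 = t 1 - t 3 - t 7 + t 9"
    "E 7 = t 1 - t 2 - t 5 + t 6"
    "E 9 = t 5 - t 6 - t 8 + t 9"
    "E 11 = t 2 - t 3 - t 8 + t 9"
    "E 13 = t 2 - t 4 - t 7 + t 9"
proof -
  define q where "q = exp (2 * of_real pi * \<i> * \<tau>)"
  define Q where "Q = q ^ 19"
  have q: "norm q < 1" "q \<noteq> 0" using \<tau> by (auto simp: q_def)
  hence Q: "Q \<noteq> 0" by (simp add: Q_def)
  have x: "norm Q < norm (q ^ a)" "norm (q ^ a) < 1" if "0 < a" "a < 19" for a
  proof -
    show "norm Q < norm (q ^ a)"
      unfolding Q_def norm_power using q that by (intro power_strict_decreasing) auto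
    show "norm (q ^ a) < 1"
      unfolding norm_power using q that by (intro power_less_one_iff[THEN iffD2]) auto
  qed
  have refl: "q ^ (19 - a) = Q / q ^ a" if "a < 19" for a
    using q that by (simp add: Q_def power_diff)
  define t where "t = (\<lambda>a. lambert_bilateral Q (q ^ a) + 1 / 2 - of_nat a / 19)"
  \<comment> \<open>Put s_a = 1/2 - a/19. For a + b + c = 19 one has s_b + s_c = a/19, so the shift
    adds the terms a/19 A(q^a) and the sum of the products of the s, which is 1/8 - (s_a^2 + s_b^2 +
    s_c^2)/2. Giving each index a third of 1/8 and substituting A = t - s yields 1/722 = 1/(2 *
    19^2) and 1/12 = 1/8 - 1/24.\<close>
  define W where "W = (\<lambda>a. lambert_bilateral2 Q (q ^ a) - lambert_bilateral Q (q ^ a) + of_nat a / 19 * t a + of_nat a ^ 2 / 722 - 1 / 12)"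
  have nat19: "of_nat (19 - a) = (19 - of_nat a :: complex)" if "a < 19" for a
    using that by (simp add: of_nat_diff)
  have t_refl: "t (19 - a) = - t a" if "0 < a" "a < 19" for a
    using lambert_bilateral_reflect(1)[OF Q x[OF that]] that by (simp add: t_def refl nat19 field_simps)
  have W_refl: "W (19 - a) = W a" if "0 < a" "a < 19" for a
  proof -
    have "W (19 - a) = lambert_bilateral2 Q (q ^ a) + (19 - of_nat a) / 19 * (- t a) + (19 - of_nat a) ^ 2 / 722 - 1 / 12"
      unfolding W_def t_refl[OF that] refl[OF that(2)] lambert_bilateral_reflect[OF Q x[OF that]] nat19[OF that(2)] by simp
    also have "\<dots> = W a"
      by (simp add: W_def t_def field_simps power2_eq_square)
    finally show ?thesis .
  qed
  have rel: "t a * t b + t a * t c + t b * t c = W a + W b + W c"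
    if "0 < a" "0 < b" "0 < c" "a + b + c = 19" for a b c
  proof -
    define d where "d = a + b"
    have d: "0 < d" "d < 19" "c = 19 - d" using that by (auto simp: d_def)
    have ab: "a < 19" "b < 19" using that by auto
    have tc: "t c = - t d" "W c = W d" unfolding d(3) using t_refl W_refl d by auto
    have "q ^ a * q ^ b = q ^ d" by (simp add: d_def power_add)
    with lambert_bilateral_mult[of Q "q ^ a" "q ^ b"] x[OF d(1,2)] x(2) that ab Q
    have *: "lambert_bilateral Q (q ^ a) * lambert_bilateral Q (q ^ b) - lambert_bilateral Q (q ^ a) * lambert_bilateral Q (q ^ d) - lambert_bilateral Q (q ^ b) * lambert_bilateral Q (q ^ d) =
        lambert_bilateral2 Q (q ^ d) + (lambert_bilateral2 Q (q ^ a) - lambert_bilateral Q (q ^ a)) + (lambert_bilateral2 Q (q ^ b) - lambert_bilateral Q (q ^ b))"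
      by simp
    have dd: "of_nat d = (of_nat a + of_nat b :: complex)" by (simp add: d_def)
    have L2: "lambert_bilateral2 Q (q ^ d) = lambert_bilateral Q (q ^ a) * lambert_bilateral Q (q ^ b) - lambert_bilateral Q (q ^ a) * lambert_bilateral Q (q ^ d) - lambert_bilateral Q (q ^ b) * lambert_bilateral Q (q ^ d)
        - (lambert_bilateral2 Q (q ^ a) - lambert_bilateral Q (q ^ a)) - (lambert_bilateral2 Q (q ^ b) - lambert_bilateral Q (q ^ b))"
      using * by (simp add: algebra_simps)
    show ?thesis
      unfolding tc unfolding W_def t_def L2 dd by (simp add: field_simps power2_eq_square)
  qed
  define g where "g = (\<lambda>a. lambert Q (q ^ a))"
  \<comment> \<open>Oddness of the characters makes \<open>g\<close> enter only through differences
    g(c) - g(19 - c), and each of these is t(c) up to a rational constant.\<close>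
  have lamb: "g (19 - a) = g a - t a + 1 / 2 - of_nat a / 19" if "0 < a" "a < 19" for a
    using lambert_bilateral_eq_lambert[OF Q x[OF that]] refl[OF that(2)] by (simp add: t_def g_def)
  have l: "g 18 = g 1 - t 1 + 1 / 2 - 1 / 19"
    "g 17 = g 2 - t 2 + 1 / 2 - 2 / 19"
    "g 16 = g 3 - t 3 + 1 / 2 - 3 / 19"
    "g 15 = g 4 - t 4 + 1 / 2 - 4 / 19"
    "g 14 = g 5 - t 5 + 1 / 2 - 5 / 19"
    "g 13 = g 6 - t 6 + 1 / 2 - 6 / 19"
    "g 12 = g 7 - t 7 + 1 / 2 - 7 / 19"
    "g 11 = g 8 - t 8 + 1 / 2 - 8 / 19"
    "g 10 = g 9 - t 9 + 1 / 2 - 9 / 19"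
    using lamb[of 1] lamb[of 2] lamb[of 3] lamb[of 4] lamb[of 5] lamb[of 6] lamb[of 7] lamb[of 8] lamb[of 9]
    by simp_all
  define D where "D = (\<lambda>n::int. if [n = 1] (mod 19) then 1 else if [n = -1] (mod 19) then -1 else (0::complex))"
  have expand: "E a = D a + (\<Sum>j\<in>{4,5,11,13}. \<Sum>c<19. D (a * j * int (Suc c)) * g (Suc c))" for a
    unfolding D_def g_def Q_def q_def E by (rule eisenstein_E_19[OF \<tau>])
  \<comment> \<open>For each j in {4, 5, 11, 13} the indicator \<open>D\<close> selects c = 1/(a j)
    and its negative modulo 19. The rational constants of the four differences add up to the
    opposite of \<open>D a\<close>, so no constant survives.\<close>
  have es:
    "E 1 = t 3 + t 4 + t 5 + t 7"
    "E 2 = t 2 - t 6 - t 7 - t 8"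
    "E 3 = t 1 - t 4 - t 5 + t 8"
    "E 4 = t 1 - t 3 - t 4 + t 6"
    "E 5 = t 1 - t 3 - t 7 + t 9"
    "E 7 = t 1 - t 2 - t 5 + t 6"
    "E 9 = t 5 - t 6 - t 8 + t 9"
    "E 11 = t 2 - t 3 - t 8 + t 9"
    "E 13 = t 2 - t 4 - t 7 + t 9"
    unfolding expand
    by (simp_all add: sum_lessThan_19 D_def cong_def)
       (simp_all add: l numeral_2_eq_2)
  show ?thesis using that[of t W] rel t_refl W_refl es by blast
qed

theorem theorem5p5:
  fixes \<tau> :: complex and E :: "int \<Rightarrow> complex"
  assumes "Im \<tau> > 0"
    and "\<And>a. E a = eisenstein_E 19 a \<tau>"
  shows
    "E 2 * E 5 - E 4 * E 5 + E 7 * E 5 - 3 * E 9 * E 5 + E 11 * E 5 + E 13 * E 5 + E 7 * E 9 - E 7 * E 11 - E 2 * E 13 - E 3 * E 13 + E 9 * E 13 - E 11 * E 13 = 0 \<and>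
     -E 1 * E 5 + E 2 * E 5 + E 3 * E 5 - E 4 * E 5 + E 7 * E 5 - E 11 * E 5 - E 13 * E 5 + E 1 * E 7 - E 2 * E 13 - E 3 * E 13 + E 11 * E 13 = 0 \<and>
     -E 2 * E 5 - E 3 * E 5 + E 7 * E 5 - E 9 * E 5 + E 11 * E 5 + E 13 * E 5 + E 2 * E 7 - E 7 * E 11 + E 2 * E 13 - E 11 * E 13 = 0 \<and>
     E 2 * E 5 + E 3 * E 5 - E 7 * E 5 - E 11 * E 5 - E 13 * E 5 + E 3 * E 11 - E 2 * E 13 - E 3 * E 13 + E 11 * E 13 = 0 \<and>
     -E 2 * E 5 - E 3 * E 5 + E 7 * E 5 + E 9 * E 5 + E 13 * E 5 + E 2 * E 11 + E 3 * E 13 - E 11 * E 13 = 0 \<and>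
     -E 2 * E 5 - E 3 * E 5 + E 4 * E 5 + E 9 * E 5 + E 1 * E 9 + E 2 * E 13 + E 3 * E 13 = 0 \<and>
     -E 2 * E 3 + E 5 * E 3 + E 9 * E 3 + E 2 * E 5 - E 4 * E 5 - E 2 * E 13 = 0 \<and>
     -E 3 * E 5 - E 9 * E 5 + E 13 * E 5 + E 1 * E 13 + E 3 * E 13 = 0 \<and>
     E 3 * E 5 - E 4 * E 5 + E 4 * E 11 - E 3 * E 13 = 0 \<and>
     E 2 * E 4 - E 5 * E 9 - E 3 * E 13 = 0"
proof -
  obtain t W :: "nat \<Rightarrow> complex" where
    rel: "\<And>a b c. 0 < a \<Longrightarrow> 0 < b \<Longrightarrow> 0 < c \<Longrightarrow> a + b + c = 19 \<Longrightarrow> t a * t b + t a * t c + t b * t c = W a + W b + W c"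
    and t_refl: "\<And>a. 0 < a \<Longrightarrow> a < 19 \<Longrightarrow> t (19 - a) = - t a"
    and W_refl: "\<And>a. 0 < a \<Longrightarrow> a < 19 \<Longrightarrow> W (19 - a) = W a"
    and E:
    "E 1 = t 3 + t 4 + t 5 + t 7"
    "E 2 = t 2 - t 6 - t 7 - t 8"
    "E 3 = t 1 - t 4 - t 5 + t 8"
    "E 4 = t 1 - t 3 - t 4 + t 6"
    "E 5 = t 1 - t 3 - t 7 + t 9"
    "E 7 = t 1 - t 2 - t 5 + t 6"
    "E 9 = t 5 - t 6 - t 8 + t 9"
    "E 11 = t 2 - t 3 - t 8 + t 9"
    "E 13 = t 2 - t 4 - t 7 + t 9"
    by (rule eisenstein_E_19_relations[OF assms]) (rule that)
  \<comment> \<open>A part of a sum of three positive integers equal to 19 is at most 17, so these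
    reflections bring every index down to 1..9.\<close>
  have t: "t 10 = - t 9" "t 11 = - t 8" "t 12 = - t 7" "t 13 = - t 6" "t 14 = - t 5" "t 15 = - t 4"
    "t 16 = - t 3" "t 17 = - t 2"
    using t_refl[of 2] t_refl[of 3] t_refl[of 4] t_refl[of 5] t_refl[of 6] t_refl[of 7] t_refl[of 8] t_refl[of 9]
    by simp_all
  have W: "W 10 = W 9" "W 11 = W 8" "W 12 = W 7" "W 13 = W 6" "W 14 = W 5" "W 15 = W 4" "W 16 = W 3" "W 17 = W 2"
    using W_refl[of 2] W_refl[of 3] W_refl[of 4] W_refl[of 5] W_refl[of 6] W_refl[of 7] W_refl[of 8] W_refl[of 9]
    by simp_all
  \<comment> \<open>The defect of one quadratic relation. In each identity below, the integer
    coefficients of the R terms solve the linear system that matches every monomial t_i t_j and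
    makes every W_i cancel. Unfolding then leaves a polynomial identity in free variables, while
    each R vanishes.\<close>
  define R where "R = (\<lambda>a b c. t a * t b + t a * t c + t b * t c - (W a + W b + W c))"
  have R: "R a b c = 0" if "0 < a" "0 < b" "0 < c" "a + b + c = 19" for a b c
    using rel[OF that] by (simp add: R_def)
  have "E 2 * E 5 - E 4 * E 5 + E 7 * E 5 - 3 * E 9 * E 5 + E 11 * E 5 + E 13 * E 5 + E 7 * E 9 - E 7 * E 11 - E 2 * E 13 - E 3 * E 13 + E 9 * E 13 - E 11 * E 13 =
      R 1 3 15 + 2 * R 1 4 14 - R 1 5 13 - R 1 7 11 - R 1 9 9 - R 2 2 15 - 2 * R 2 3 14 + R 2 4 13 + R 2 6 11 + R 2 7 10 + R 2 8 9 + R 3 5 11 - R 3 6 10 + R 3 7 9 - R 4 4 11 + R 4 6 9 - 2 * R 4 7 8 - R 5 5 9 + R 5 6 8 + R 5 7 7 - R 6 6 7"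
    unfolding R_def E t W by (simp add: algebra_simps)
  also have "\<dots> = 0" by (simp add: R)
  finally have eq1: "E 2 * E 5 - E 4 * E 5 + E 7 * E 5 - 3 * E 9 * E 5 + E 11 * E 5 + E 13 * E 5 + E 7 * E 9 - E 7 * E 11 - E 2 * E 13 - E 3 * E 13 + E 9 * E 13 - E 11 * E 13 = 0" .
  have "-E 1 * E 5 + E 2 * E 5 + E 3 * E 5 - E 4 * E 5 + E 7 * E 5 - E 11 * E 5 - E 13 * E 5 + E 1 * E 7 - E 2 * E 13 - E 3 * E 13 + E 11 * E 13 =
      R 1 1 17 - R 1 2 16 + 2 * R 1 4 14 - R 1 6 12 - R 1 7 11 - R 1 9 9 - R 2 3 14 - R 2 5 12 + R 2 6 11 + R 2 7 10 - R 3 3 13 + R 3 4 12 + R 3 5 11 + 2 * R 3 7 9 - R 4 4 11 - R 4 7 8 - R 5 5 9 + R 5 6 8"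
    unfolding R_def E t W by (simp add: algebra_simps)
  also have "\<dots> = 0" by (simp add: R)
  finally have eq2: "-E 1 * E 5 + E 2 * E 5 + E 3 * E 5 - E 4 * E 5 + E 7 * E 5 - E 11 * E 5 - E 13 * E 5 + E 1 * E 7 - E 2 * E 13 - E 3 * E 13 + E 11 * E 13 = 0" .
  have "-E 2 * E 5 - E 3 * E 5 + E 7 * E 5 - E 9 * E 5 + E 11 * E 5 + E 13 * E 5 + E 2 * E 7 - E 7 * E 11 + E 2 * E 13 - E 11 * E 13 =
      - R 1 5 13 + R 1 6 12 + R 3 3 13 - R 3 4 12 - R 3 7 9 + R 4 6 9 + R 5 7 7 - R 6 6 7"
    unfolding R_def E t W by (simp add: algebra_simps)
  also have "\<dots> = 0" by (simp add: R)
  finally have eq3: "-E 2 * E 5 - E 3 * E 5 + E 7 * E 5 - E 9 * E 5 + E 11 * E 5 + E 13 * E 5 + E 2 * E 7 - E 7 * E 11 + E 2 * E 13 - E 11 * E 13 = 0" .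
  have "E 2 * E 5 + E 3 * E 5 - E 7 * E 5 - E 11 * E 5 - E 13 * E 5 + E 3 * E 11 - E 2 * E 13 - E 3 * E 13 + E 11 * E 13 =
      R 1 4 14 + R 1 5 13 - R 1 6 12 - R 1 9 9 - R 2 3 14 - R 2 5 12 + R 2 6 11 + R 2 8 9 - R 3 3 13 + 2 * R 3 4 12 + 2 * R 3 7 9 - R 3 8 8 - R 4 4 11 - R 4 6 9 + R 5 6 8 - R 5 7 7"
    unfolding R_def E t W by (simp add: algebra_simps)
  also have "\<dots> = 0" by (simp add: R)
  finally have eq4: "E 2 * E 5 + E 3 * E 5 - E 7 * E 5 - E 11 * E 5 - E 13 * E 5 + E 3 * E 11 - E 2 * E 13 - E 3 * E 13 + E 11 * E 13 = 0" .
  have "-E 2 * E 5 - E 3 * E 5 + E 7 * E 5 + E 9 * E 5 + E 13 * E 5 + E 2 * E 11 + E 3 * E 13 - E 11 * E 13 =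
      - R 1 4 14 + R 1 6 12 - R 1 8 10 + R 1 9 9 + R 2 3 14 - R 2 6 11 + R 2 7 10 - R 2 8 9 - R 3 4 12 - R 3 7 9 + R 3 8 8 + R 4 4 11"
    unfolding R_def E t W by (simp add: algebra_simps)
  also have "\<dots> = 0" by (simp add: R)
  finally have eq5: "-E 2 * E 5 - E 3 * E 5 + E 7 * E 5 + E 9 * E 5 + E 13 * E 5 + E 2 * E 11 + E 3 * E 13 - E 11 * E 13 = 0" .
  have "-E 2 * E 5 - E 3 * E 5 + E 4 * E 5 + E 9 * E 5 + E 1 * E 9 + E 2 * E 13 + E 3 * E 13 =
      - R 1 3 15 - 2 * R 1 4 14 + R 1 6 12 + R 1 7 11 + R 1 9 9 + R 2 2 15 + R 2 3 14 - R 2 6 11 - R 2 7 10 - R 2 8 9 + R 3 3 13 - R 3 4 12 - R 3 7 9 + R 4 4 11 + R 4 7 8 + R 5 5 9 - R 5 6 8"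
    unfolding R_def E t W by (simp add: algebra_simps)
  also have "\<dots> = 0" by (simp add: R)
  finally have eq6: "-E 2 * E 5 - E 3 * E 5 + E 4 * E 5 + E 9 * E 5 + E 1 * E 9 + E 2 * E 13 + E 3 * E 13 = 0" .
  have "-E 2 * E 3 + E 5 * E 3 + E 9 * E 3 + E 2 * E 5 - E 4 * E 5 - E 2 * E 13 =
      R 1 3 15 + R 1 4 14 + R 1 5 13 - R 1 6 12 - R 1 7 11 - R 1 8 10 - R 2 2 15 - R 2 3 14 + R 2 6 11 + R 2 7 10 + R 2 8 9 - R 3 3 13 + R 3 4 12 + R 3 7 9 - R 4 6 9 - R 4 7 8 - R 5 5 9 + R 5 6 8"
    unfolding R_def E t W by (simp add: algebra_simps)
  also have "\<dots> = 0" by (simp add: R)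
  finally have eq7: "-E 2 * E 3 + E 5 * E 3 + E 9 * E 3 + E 2 * E 5 - E 4 * E 5 - E 2 * E 13 = 0" .
  have "-E 3 * E 5 - E 9 * E 5 + E 13 * E 5 + E 1 * E 13 + E 3 * E 13 =
      - R 1 1 17 + R 1 3 15 + R 1 6 12 + R 2 8 9 - R 3 6 10 - R 4 7 8"
    unfolding R_def E t W by (simp add: algebra_simps)
  also have "\<dots> = 0" by (simp add: R)
  finally have eq8: "-E 3 * E 5 - E 9 * E 5 + E 13 * E 5 + E 1 * E 13 + E 3 * E 13 = 0" .
  have "E 3 * E 5 - E 4 * E 5 + E 4 * E 11 - E 3 * E 13 =
      R 1 4 14 - R 1 6 12 - R 2 3 14 + R 2 6 11 + R 3 4 12 - R 4 4 11"
    unfolding R_def E t W by (simp add: algebra_simps)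
  also have "\<dots> = 0" by (simp add: R)
  finally have eq9: "E 3 * E 5 - E 4 * E 5 + E 4 * E 11 - E 3 * E 13 = 0" .
  have "E 2 * E 4 - E 5 * E 9 - E 3 * E 13 =
      R 1 4 14 - R 1 9 9 - R 2 3 14 + R 2 6 11 + R 3 7 9 - R 4 4 11 + R 4 6 9 - R 6 6 7"
    unfolding R_def E t W by (simp add: algebra_simps)
  also have "\<dots> = 0" by (simp add: R)
  finally have eq10: "E 2 * E 4 - E 5 * E 9 - E 3 * E 13 = 0" .
  show ?thesis by (intro conjI eq1 eq2 eq3 eq4 eq5 eq6 eq7 eq8 eq9 eq10)
qed

end
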